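(* Let $X,Y$ be compact Hausdorff spaces, let $E$ and $F$ be real or complex Banach spaces, let $A(X,E)$ be a subspace of $C(X,E)$ containing all constant functions, and let $A(X)$ be a regular Banach function algebra on $X$ such that $A(X)\cdot A(X,E)\subseteq A(X,E)$. Suppose that $(A(X,E),\|\cdot\|_\infty)$ and $(A(X),\|\cdot\|_\infty)$ have property (P). Let $T:A(X)\to C(Y)$ and $S:A(X,E)\to C(Y,F)$ be continuous (with respect to the supremum norms) real-linear jointly separating maps such that the ranges of $T$ and $S$ contain all constant functions. Then there exist a continuous map $\phi:Y\to X$ and a map $\Lambda^S:Y\to L(E,F)$, $y\mapsto\Lambda^S_y$, continuous with respect to the strong operator topology, such that $$Tf(y)=\mathrm{Re}\big(f(\phi(y))\big)\,T1(y)+\mathrm{Im}\big(f(\phi(y))\big)\,Ti(y)\qquad(f\in A(X),\ y\in Y)$$ and $$Sg(y)=\Lambda^S_y\big(g(\phi(y))\big)\qquad(g\in A(X,E),\ y\in Y).$$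
   Context: $C(X,E)$ is the space of all continuous functions $X\to E$ with the supremum norm $\|\cdot\|_\infty$; $C(Y)$ is the space of continuous complex-valued functions on $Y$. $1$ and $i$ also denote the corresponding constant functions in $A(X)$. $L(E,F)$ is the space of continuous linear operators $E\to F$, where, since $S$ is only real-linear, linear means real-linear. For a function $f$, $\mathrm{coz}(f)=\{x: f(x)\neq 0\}$. A Banach function algebra on $X$ is a complex subalgebra $A(X)$ of the algebra of continuous complex-valued functions on $X$ that contains the constants, separates the points of $X$, and is a Banach algebra under some norm. It is regular if for every closed subset $K$ of its maximal ideal space and every $\varphi\notin K$ in the maximal ideal space there is $f\in A(X)$ whose Gelfand transform satisfies $\widehat f(\varphi)=1$ and $\widehat f=0$ on $K$. $A(X)\cdot A(X,E)=\{f\cdot h:f\in A(X),h\in A(X,E)\}$, where $(f\cdot h)(x)=f(x)h(x)$. Property (P) for a space $(A,\|\cdot\|_\infty)$ of continuous functions on $X$: for each $f\in A$ and $x\in X$ with $f(x)=0$ there is a sequence $\{f_n\}$ in $A$ such that each $f_n$ vanishes on a neighborhood of $x$ and $\|f_n-f\|_\infty\to0$. $T:A(X)\to C(Y)$ and $S:A(X,E)\to C(Y,F)$ are jointly separating if $f\cdot g=0$ implies $Tf\cdot Sg=0$ for $f\in A(X)$, $g\in A(X,E)$; that is, $\mathrm{coz}(f)\cap\mathrm{coz}(g)=\emptyset$ implies $\mathrm{coz}(Tf)\cap\mathrm{coz}(Sg)=\emptyset$.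
   Formalization: E is taken to be a complex Banach space, since f·h with complex-valued f in A(X) is undefined for merely real E, and F is assumed nonzero, since for F = 0 the claim about T fails (e.g. X two points, Y one point, S = 0, Tf the average of f). *)

theory Defs
  imports "HOL-Analysis.Analysis"
begin

text \<open>
  A complex Banach space is a real one together with a complex scalar multiplication that extends
  the real one and is compatible with the norm. A real Banach space is just \<^class>\<open>banach\<close>.
\<close>

class complex_normed_vector = real_normed_vector +
  fixes scaleC :: "complex \<Rightarrow> 'a \<Rightarrow> 'a" (infixr "*\<^sub>C" 75)
  assumes scaleC_add_right: "a *\<^sub>C (x + y) = a *\<^sub>C x + a *\<^sub>C y"
    and scaleC_add_left: "(a + b) *\<^sub>C x = a *\<^sub>C x + b *\<^sub>C x"
    and scaleC_scaleC: "a *\<^sub>C (b *\<^sub>C x) = (a * b) *\<^sub>C x"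
    and scaleC_of_real: "complex_of_real r *\<^sub>C x = r *\<^sub>R x"
    and norm_scaleC: "norm (a *\<^sub>C x) = cmod a * norm x"

class complex_banach = complex_normed_vector + banach

instantiation complex :: complex_normed_vector
begin

definition scaleC_complex :: "complex \<Rightarrow> complex \<Rightarrow> complex" where
  "scaleC_complex = (*)"

instance
  by standard (auto simp: scaleC_complex_def algebra_simps norm_mult scaleR_conv_of_real)

end

instance complex :: complex_banach ..

lemma bounded_bilinear_scaleC:
  "bounded_bilinear (scaleC :: complex \<Rightarrow> 'a \<Rightarrow> 'a::complex_normed_vector)"
proof
  fix r :: real and a :: complex and b :: 'a
  show "(r *\<^sub>R a) *\<^sub>C b = r *\<^sub>R (a *\<^sub>C b)"
    by (simp add: scaleR_conv_of_real scaleC_of_real flip: scaleC_scaleC)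
  show "a *\<^sub>C (r *\<^sub>R b) = r *\<^sub>R (a *\<^sub>C b)"
    by (simp add: scaleC_scaleC mult.commute flip: scaleC_of_real)
  show "\<exists>K. \<forall>(a::complex) (b::'a). norm (a *\<^sub>C b) \<le> norm a * norm b * K"
    by (rule exI[of _ 1]) (simp add: norm_scaleC)
qed (simp_all add: scaleC_add_left scaleC_add_right)

lemma scaleC_in_bcontfun:
  fixes f :: "'x::topological_space \<Rightarrow> complex" and h :: "'x \<Rightarrow> 'e::complex_normed_vector"
  assumes "f \<in> bcontfun" and "h \<in> bcontfun"
  shows "(\<lambda>x. f x *\<^sub>C h x) \<in> bcontfun"
proof -
  obtain a b where a: "\<And>x. norm (f x) \<le> a" and b: "\<And>x. norm (h x) \<le> b"
    using assms by (auto simp: bcontfun_def bounded_iff)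
  have "0 \<le> a"
    using a[of undefined] norm_ge_zero[of "f undefined"] by linarith
  with a b have "norm (f x *\<^sub>C h x) \<le> a * b" for x
    by (simp add: norm_scaleC mult_mono)
  moreover have "continuous_on UNIV (\<lambda>x. f x *\<^sub>C h x)"
    using assms by (auto simp: bcontfun_def intro: bounded_bilinear.continuous_on[OF bounded_bilinear_scaleC])
  ultimately show ?thesis
    by (intro bcontfun_normI)
qed

text \<open>
  For compact \<open>X\<close> every continuous function is bounded, so the type \<open>'x \<Rightarrow>\<^sub>C 'e\<close> of bounded
  continuous functions is \<open>C(X,E)\<close> and its \<^const>\<open>norm\<close> is the supremum norm.
\<close>

definition bcontfun_mult ::
  "('x::topological_space \<Rightarrow>\<^sub>C complex) \<Rightarrow> ('x \<Rightarrow>\<^sub>C 'e::complex_normed_vector) \<Rightarrow> ('x \<Rightarrow>\<^sub>C 'e)"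
  (infixl "\<odot>" 70) where
  "f \<odot> h = Bcontfun (\<lambda>x. apply_bcontfun f x *\<^sub>C apply_bcontfun h x)"

lemma apply_bcontfun_mult [simp]:
  "apply_bcontfun (f \<odot> h) x = apply_bcontfun f x *\<^sub>C apply_bcontfun h x"
  unfolding bcontfun_mult_def
  by (subst Bcontfun_inverse) (auto intro: scaleC_in_bcontfun apply_bcontfun)

instantiation bcontfun :: (topological_space, complex_normed_vector) complex_normed_vector
begin

definition scaleC_bcontfun :: "complex \<Rightarrow> ('a \<Rightarrow>\<^sub>C 'b) \<Rightarrow> ('a \<Rightarrow>\<^sub>C 'b)" where
  "scaleC_bcontfun c h = Bcontfun (\<lambda>x. c *\<^sub>C apply_bcontfun h x)"

lemma apply_bcontfun_scaleC [simp]: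
  "apply_bcontfun (c *\<^sub>C h) x = c *\<^sub>C apply_bcontfun h x" for h :: "'a \<Rightarrow>\<^sub>C 'b"
  unfolding scaleC_bcontfun_def
  by (subst Bcontfun_inverse) (auto intro: scaleC_in_bcontfun const_bcontfun apply_bcontfun)

instance
proof
  fix a b :: complex and f g :: "'a \<Rightarrow>\<^sub>C 'b" and r :: real
  show "a *\<^sub>C (f + g) = a *\<^sub>C f + a *\<^sub>C g"
    by (rule bcontfun_eqI) (simp add: scaleC_add_right)
  show "(a + b) *\<^sub>C f = a *\<^sub>C f + b *\<^sub>C f"
    by (rule bcontfun_eqI) (simp add: scaleC_add_left)
  show assoc: "a *\<^sub>C (b *\<^sub>C f) = (a * b) *\<^sub>C f" for a b and f :: "'a \<Rightarrow>\<^sub>C 'b"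
    by (rule bcontfun_eqI) (simp add: scaleC_scaleC)
  show real: "complex_of_real r *\<^sub>C f = r *\<^sub>R f" for r and f :: "'a \<Rightarrow>\<^sub>C 'b"
    by (rule bcontfun_eqI) (simp add: scaleC_of_real)
  have le: "norm (c *\<^sub>C h) \<le> cmod c * norm h" for c and h :: "'a \<Rightarrow>\<^sub>C 'b"
    by (rule norm_bound)
      (simp add: norm_scaleC mult_left_mono norm_bounded)
  show "norm (a *\<^sub>C f) = cmod a * norm f"
  proof (cases "a = 0")
    case True
    then show ?thesis using real[of 0 f] by simp
  next
    case False
    have "f = inverse a *\<^sub>C (a *\<^sub>C f)"
      using False real[of 1 f] by (simp add: assoc)
    then have "norm f \<le> cmod (inverse a) * norm (a *\<^sub>C f)"
      using le by metis
    then have "cmod a * norm f \<le> norm (a *\<^sub>C f)"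
      using False by (simp add: norm_inverse field_simps norm_divide)
    then show ?thesis using le[of a f] by simp
  qed
qed

end

definition coz :: "('x \<Rightarrow> 'v::zero) \<Rightarrow> 'x set" where
  "coz f = {x. f x \<noteq> 0}"

definition complex_subalgebra :: "('x::topological_space \<Rightarrow>\<^sub>C complex) set \<Rightarrow> bool" where
  "complex_subalgebra A \<longleftrightarrow> 0 \<in> A \<and> (\<forall>f\<in>A. \<forall>g\<in>A. f + g \<in> A) \<and>
     (\<forall>c. \<forall>f\<in>A. c *\<^sub>C f \<in> A) \<and> (\<forall>f\<in>A. \<forall>g\<in>A. f \<odot> g \<in> A)"

text \<open>The norm \<open>N\<close> is unrelated to the supremum norm; its values outside \<open>A\<close> are irrelevant.\<close>

definition banach_algebra_norm ::
  "('x::topological_space \<Rightarrow>\<^sub>C complex) set \<Rightarrow> (('x \<Rightarrow>\<^sub>C complex) \<Rightarrow> real) \<Rightarrow> bool" where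
  "banach_algebra_norm A N \<longleftrightarrow>
     (\<forall>f\<in>A. 0 \<le> N f) \<and> (\<forall>f\<in>A. N f = 0 \<longleftrightarrow> f = 0) \<and>
     (\<forall>c. \<forall>f\<in>A. N (c *\<^sub>C f) = cmod c * N f) \<and>
     (\<forall>f\<in>A. \<forall>g\<in>A. N (f + g) \<le> N f + N g) \<and>
     (\<forall>f\<in>A. \<forall>g\<in>A. N (f \<odot> g) \<le> N f * N g) \<and>
     (\<forall>s. (\<forall>n. s n \<in> A) \<longrightarrow>
        (\<forall>\<epsilon>>0. \<exists>M. \<forall>m\<ge>M. \<forall>n\<ge>M. N (s m - s n) < \<epsilon>) \<longrightarrow>
        (\<exists>l\<in>A. (\<lambda>n. N (s n - l)) \<longlonglongrightarrow> 0))"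

definition banach_function_algebra :: "('x::topological_space \<Rightarrow>\<^sub>C complex) set \<Rightarrow> bool" where
  "banach_function_algebra A \<longleftrightarrow>
     complex_subalgebra A \<and> range const_bcontfun \<subseteq> A \<and>
     (\<forall>x y. x \<noteq> y \<longrightarrow> (\<exists>f\<in>A. apply_bcontfun f x \<noteq> apply_bcontfun f y)) \<and>
     (\<exists>N. banach_algebra_norm A N)"

text \<open>
  The maximal ideal space is realised as the set of nonzero multiplicative complex-linear
  functionals on \<open>A\<close> with the topology of pointwise convergence on \<open>A\<close>. Functionals are made
  extensional so that each is represented by exactly one HOL function.
\<close>

definition characters ::
  "('x::topological_space \<Rightarrow>\<^sub>C complex) set \<Rightarrow> (('x \<Rightarrow>\<^sub>C complex) \<Rightarrow> complex) set" where
  "characters A = {\<psi> \<in> extensional A.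
     (\<forall>f\<in>A. \<forall>g\<in>A. \<psi> (f + g) = \<psi> f + \<psi> g) \<and>
     (\<forall>c. \<forall>f\<in>A. \<psi> (c *\<^sub>C f) = c * \<psi> f) \<and>
     (\<forall>f\<in>A. \<forall>g\<in>A. \<psi> (f \<odot> g) = \<psi> f * \<psi> g) \<and>
     (\<exists>f\<in>A. \<psi> f \<noteq> 0)}"

definition maximal_ideal_space ::
  "('x::topological_space \<Rightarrow>\<^sub>C complex) set \<Rightarrow> (('x \<Rightarrow>\<^sub>C complex) \<Rightarrow> complex) topology" where
  "maximal_ideal_space A = subtopology (product_topology (\<lambda>_. euclidean) A) (characters A)"

definition gelfand_transform ::
  "('x::topological_space \<Rightarrow>\<^sub>C complex) \<Rightarrow> (('x \<Rightarrow>\<^sub>C complex) \<Rightarrow> complex) \<Rightarrow> complex" where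
  "gelfand_transform f \<psi> = \<psi> f"

definition regular_algebra :: "('x::topological_space \<Rightarrow>\<^sub>C complex) set \<Rightarrow> bool" where
  "regular_algebra A \<longleftrightarrow>
     (\<forall>K \<psi>. closedin (maximal_ideal_space A) K \<longrightarrow>
        \<psi> \<in> topspace (maximal_ideal_space A) - K \<longrightarrow>
        (\<exists>f\<in>A. gelfand_transform f \<psi> = 1 \<and> (\<forall>\<eta>\<in>K. gelfand_transform f \<eta> = 0)))"

definition property_P :: "('x::topological_space \<Rightarrow>\<^sub>C 'e::real_normed_vector) set \<Rightarrow> bool" where
  "property_P A \<longleftrightarrow>
     (\<forall>f\<in>A. \<forall>x. apply_bcontfun f x = 0 \<longrightarrow>
        (\<exists>s. (\<forall>n. s n \<in> A \<and> (\<exists>U. open U \<and> x \<in> U \<and> (\<forall>z\<in>U. apply_bcontfun (s n) z = 0))) \<and>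
             s \<longlonglongrightarrow> f))"

definition real_linear_on :: "'a::real_vector set \<Rightarrow> ('a \<Rightarrow> 'b::real_vector) \<Rightarrow> bool" where
  "real_linear_on A T \<longleftrightarrow>
     (\<forall>f\<in>A. \<forall>g\<in>A. T (f + g) = T f + T g) \<and> (\<forall>r. \<forall>f\<in>A. T (r *\<^sub>R f) = r *\<^sub>R T f)"

text \<open>
  Stated with cozero sets, since the product \<open>Tf \<cdot> Sg\<close> is only defined when the target space of
  \<open>S\<close> is complex.
\<close>

definition jointly_separating ::
  "('x::topological_space \<Rightarrow>\<^sub>C complex) set \<Rightarrow> ('x \<Rightarrow>\<^sub>C 'e::real_normed_vector) set \<Rightarrow>
   (('x \<Rightarrow>\<^sub>C complex) \<Rightarrow> ('y::topological_space \<Rightarrow>\<^sub>C complex)) \<Rightarrow>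
   (('x \<Rightarrow>\<^sub>C 'e) \<Rightarrow> ('y \<Rightarrow>\<^sub>C 'f::real_normed_vector)) \<Rightarrow> bool" where
  "jointly_separating A B T S \<longleftrightarrow>
     (\<forall>f\<in>A. \<forall>g\<in>B. coz (apply_bcontfun f) \<inter> coz (apply_bcontfun g) = {} \<longrightarrow>
        coz (apply_bcontfun (T f)) \<inter> coz (apply_bcontfun (S g)) = {})"

end

theory Submission
  imports Defs
begin

text \<open>
  Fix \<open>y\<close> and consider the functionals \<open>t f = Tf(y)\<close> and \<open>s g = Sg(y)\<close>. The functions \<open>f \<in> A(X)\<close>
  with \<open>t(f h) = 0\<close> for all \<open>h\<close> form a proper ideal, uniformly closed in \<open>A(X)\<close>, and likewise for \<open>s\<close>.
  Gelfand theory for the uniform closure of \<open>A(X)\<close>, together with regularity (by which every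
  character of \<open>A(X)\<close> is a point evaluation), gives a common zero \<open>a\<close> of the first ideal and \<open>b\<close> of
  the second. If \<open>f\<close> vanishes near \<open>b\<close>, multiply an \<open>e \<in> A(X)\<close> supported there with \<open>e(b) = 1\<close> by
  some \<open>g\<close> such that \<open>s(e g) \<noteq> 0\<close>; separation yields \<open>t f = 0\<close>. Symmetrically \<open>s g = 0\<close> if \<open>g\<close>
  vanishes near \<open>a\<close>. This forces \<open>a = b\<close>, which is \<open>\<phi>(y)\<close>, and property (P) passes from vanishing
  near \<open>\<phi>(y)\<close> to vanishing at \<open>\<phi>(y)\<close>.
\<close>

section \<open>The Banach algebra of bounded continuous functions\<close>

setup_lifting type_definition_bcontfun

text \<open>Pointwise multiplication makes geometric series in normed algebras available for scalar
  functions; there it coincides with \<open>\<odot>\<close>.\<close>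

instantiation bcontfun :: (topological_space, real_normed_algebra_1) real_normed_algebra_1
begin

lift_definition one_bcontfun :: "'a \<Rightarrow>\<^sub>C 'b" is "\<lambda>_. 1"
  by (rule const_bcontfun)

lift_definition times_bcontfun :: "('a \<Rightarrow>\<^sub>C 'b) \<Rightarrow> ('a \<Rightarrow>\<^sub>C 'b) \<Rightarrow> 'a \<Rightarrow>\<^sub>C 'b" is "\<lambda>f g x. f x * g x"
proof -
  fix f g :: "'a \<Rightarrow> 'b"
  assume "f \<in> bcontfun" "g \<in> bcontfun"
  then obtain a b where ab: "\<And>x. norm (f x) \<le> a" "\<And>x. norm (g x) \<le> b"
      and "continuous_on UNIV f" "continuous_on UNIV g"
    by (auto simp: bcontfun_def bounded_iff)
  moreover have "norm (f x * g x) \<le> a * b" for x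
    using ab[of x] norm_ge_zero[of "f x"] norm_ge_zero[of "g x"]
    by (intro order_trans[OF norm_mult_ineq] mult_mono) linarith+
  ultimately show "(\<lambda>x. f x * g x) \<in> bcontfun"
    by (intro bcontfun_normI[of _ "a * b"] continuous_on_mult)
qed

lemmas [simp] = one_bcontfun.rep_eq times_bcontfun.rep_eq

instance
proof
  show "(0 :: 'a \<Rightarrow>\<^sub>C 'b) \<noteq> 1"
    by (metis one_bcontfun.rep_eq zero_bcontfun.rep_eq zero_neq_one)
  have "norm (1 :: 'a \<Rightarrow>\<^sub>C 'b) \<le> 1"
    by (rule norm_bound) simp
  moreover have "1 \<le> norm (1 :: 'a \<Rightarrow>\<^sub>C 'b)"
    using norm_bounded[of "1 :: 'a \<Rightarrow>\<^sub>C 'b" undefined] by simp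
  ultimately show "norm (1 :: 'a \<Rightarrow>\<^sub>C 'b) = 1"
    by simp
  fix f g :: "'a \<Rightarrow>\<^sub>C 'b"
  show "norm (f * g) \<le> norm f * norm g"
    by (rule norm_bound)
      (auto intro!: order_trans[OF norm_mult_ineq] mult_mono norm_bounded)
qed (auto intro!: bcontfun_eqI simp: algebra_simps)

end

instance bcontfun :: (topological_space, "{real_normed_algebra_1, comm_ring_1}") comm_ring_1
  by standard (auto intro!: bcontfun_eqI simp: algebra_simps)

text \<open>The library has the next two instances for metric domains only.\<close>

instance bcontfun :: (topological_space, complete_space) complete_space
proof
  fix s :: "nat \<Rightarrow> 'a \<Rightarrow>\<^sub>C 'b"
  assume "Cauchy s"
  then have "uniformly_Cauchy_on UNIV (\<lambda>n. apply_bcontfun (s n))"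
    unfolding uniformly_Cauchy_on_def Cauchy_def by (meson dist_fun_lt_imp_dist_val_lt)
  then obtain l where "uniform_limit UNIV (\<lambda>n. apply_bcontfun (s n)) l sequentially"
    using Cauchy_uniformly_convergent uniformly_convergent_on_def by blast
  then show "convergent s"
    by (metis convergentI sequentially_bot uniform_limit_bcontfunE)
qed

instance bcontfun :: (topological_space, banach) banach ..

lemma bcontfun_mult_eq_times: "f \<odot> g = f * g" for f g :: "'x::topological_space \<Rightarrow>\<^sub>C complex"
  by (rule bcontfun_eqI) (simp add: scaleC_complex_def)

lemma scaleC_bcontfun_eq_times: "z *\<^sub>C f = const_bcontfun z * f"
  for f :: "'x::topological_space \<Rightarrow>\<^sub>C complex"
  by (rule bcontfun_eqI) (simp add: scaleC_complex_def const_bcontfun.rep_eq)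

text \<open>Rescaling \<open>x\<close> to norm \<open>d / 2\<close> brings it into the ball on which
  \<open>f\<close> is bounded by 1. In this way continuity of \<open>S\<close> makes each
  \<Lambda>(y) a bounded operator.\<close>

lemma bounded_linear_if_continuous:
  fixes f :: "'a::real_normed_vector \<Rightarrow> 'b::real_normed_vector"
  assumes "linear f" "isCont f 0"
  shows "bounded_linear f"
proof -
  interpret linear f by fact
  obtain d where d: "d > 0" "\<And>x. norm x < d \<Longrightarrow> norm (f x) < 1"
    using assms(2) unfolding continuous_at_eps_delta by (auto simp: dist_norm zero dest: spec[of _ 1])
  have "norm (f x) \<le> norm x * (2 / d)" for x
  proof (cases "x = 0")
    case False
    have "norm ((d / (2 * norm x)) *\<^sub>R x) < d"
      using d(1) False by simp
    then have "norm (f ((d / (2 * norm x)) *\<^sub>R x)) < 1"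
      by (rule d(2))
    then show ?thesis
      using d(1) False by (simp add: scale field_simps)
  qed (simp add: zero)
  then show ?thesis
    by (intro bounded_linear.intro assms(1) bounded_linear_axioms.intro) blast
qed

lemma bounded_linear_const_bcontfun:
  "bounded_linear (const_bcontfun :: 'e::real_normed_vector \<Rightarrow> 'x::topological_space \<Rightarrow>\<^sub>C 'e)"
proof (rule bounded_linear_intro)
  show "norm (const_bcontfun v :: 'x \<Rightarrow>\<^sub>C 'e) \<le> norm v * 1" for v :: 'e
    by (rule norm_bound) (simp add: const_bcontfun.rep_eq)
qed (auto intro!: bcontfun_eqI simp: const_bcontfun.rep_eq)

section \<open>Maximal ideals and characters\<close>

lemma sum_cis_powers:
  fixes n k :: nat
  assumes "0 < k" "k < n"
  shows "(\<Sum>j<n. cis (2 * pi / n) ^ (j * k)) = 0"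
proof -
  \<comment> \<open>The ratio of a geometric sum: \<open>w\<close> is the k-th power of a primitive
    n-th root of unity, and it is not 1 because n does not divide k.\<close>
  define w where "w = cis (2 * pi * k / n)"
  have w: "cis (2 * pi / n) ^ (j * k) = w ^ j" for j
    by (simp add: w_def Complex.DeMoivre mult_ac)
  have "w ^ n = 1"
    using assms cis_multiple_2pi[of "real k"] by (simp add: w_def Complex.DeMoivre mult_ac)
  moreover have "w \<noteq> 1"
  proof
    assume "w = 1"
    then have "cos (2 * pi * k / n) = 1"
      by (simp add: w_def complex_eq_iff)
    then obtain i :: int where "2 * pi * k / n = of_int i * 2 * pi"
      unfolding cos_one_2pi_int by (elim exE)
    then have "real k = of_int (i * int n)"
      using assms by (simp add: field_simps)
    then have "int k = i * int n"
      by (metis of_int_eq_iff of_int_of_nat_eq)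
    then have "int n dvd int k" by simp
    then show False
      using assms by (simp add: nat_dvd_not_less)
  qed
  ultimately show ?thesis
    by (simp add: w sum_gp_strict)
qed

text \<open>Scalars enter through the ring homomorphism \<open>c\<close>; for functions,
  \<open>c z\<close> is the constant z. The carrier is a set because the algebra in question, the
  uniform closure of A(X), is a set of functions and not a type.\<close>

locale unital_subalgebra =
  fixes R :: "'a::comm_ring_1 set" and c :: "complex \<Rightarrow> 'a"
  assumes c_in: "c z \<in> R"
    and add_in: "a \<in> R \<Longrightarrow> b \<in> R \<Longrightarrow> a + b \<in> R"
    and mult_in: "a \<in> R \<Longrightarrow> b \<in> R \<Longrightarrow> a * b \<in> R"
    and c_add: "c (z + w) = c z + c w"
    and c_mult: "c (z * w) = c z * c w"
    and c_one: "c 1 = 1"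
begin

lemma c_zero: "c 0 = 0"
  using c_add[of 0 0] by simp

lemma c_uminus: "c (- z) = - c z"
  using c_add[of z "- z"] by (simp add: c_zero add_eq_0_iff)

lemma c_diff: "c (z - w) = c z - c w"
  using c_add[of z "- w"] by (simp add: c_uminus)

lemma c_power: "c (z ^ n) = c z ^ n"
  by (induction n) (simp_all add: c_one c_mult)

lemma c_sum: "c (sum f I) = (\<Sum>i\<in>I. c (f i))"
  by (induction I rule: infinite_finite_induct) (simp_all add: c_zero c_add)

lemma zero_in: "0 \<in> R" and one_in: "1 \<in> R"
  using c_in[of 0] c_in[of 1] by (simp_all add: c_zero c_one)

lemma uminus_in: "a \<in> R \<Longrightarrow> - a \<in> R"
  using mult_in[OF c_in[of "-1"], of a] by (simp add: c_uminus c_one)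

lemma diff_in: "a \<in> R \<Longrightarrow> b \<in> R \<Longrightarrow> a - b \<in> R"
  using add_in[OF _ uminus_in, of a b] by simp

lemma power_in: "a \<in> R \<Longrightarrow> a ^ n \<in> R"
  by (induction n) (auto intro: one_in mult_in)

lemma sum_in: "(\<And>i. i \<in> I \<Longrightarrow> f i \<in> R) \<Longrightarrow> sum f I \<in> R"
  by (induction I rule: infinite_finite_induct) (auto intro: zero_in add_in)

lemmas closed_under = c_in add_in mult_in zero_in one_in uminus_in diff_in power_in sum_in

end

text \<open>\<open>q\<close> stands for the quotient norm modulo an ideal, pulled back to the
  algebra. Equality in the quotient becomes \<open>q (a - b) = 0\<close>, so no quotient has to be
  formed.\<close>

locale seminormed_algebra = unital_subalgebra R c
  for R :: "'a::comm_ring_1 set" and c :: "complex \<Rightarrow> 'a" +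
  fixes q :: "'a \<Rightarrow> real"
  assumes q_nonneg: "0 \<le> q a"
    and q_add: "a \<in> R \<Longrightarrow> b \<in> R \<Longrightarrow> q (a + b) \<le> q a + q b"
    and q_mult: "a \<in> R \<Longrightarrow> b \<in> R \<Longrightarrow> q (a * b) \<le> q a * q b"
    and q_c: "q (c z) \<le> cmod z"
begin

lemma q_zero: "q 0 = 0"
  using q_c[of 0] q_nonneg[of 0] by (simp add: c_zero)

lemma q_one_le: "q 1 \<le> 1"
  using q_c[of 1] by (simp add: c_one)

lemma q_uminus: "a \<in> R \<Longrightarrow> q (- a) = q a"
proof -
  have *: "q (- a) \<le> q a" if "a \<in> R" for a
    using q_mult[OF c_in[of "-1"] that] q_c[of "-1"] q_nonneg[of a]
      mult_right_mono[of "q (c (- 1))" 1 "q a"] by (simp add: c_uminus c_one)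
  assume "a \<in> R"
  then show ?thesis
    using *[of a] *[of "- a"] by (simp add: uminus_in)
qed

lemma q_diff: "a \<in> R \<Longrightarrow> b \<in> R \<Longrightarrow> q (a - b) \<le> q a + q b"
  using q_add[of a "- b"] by (simp add: uminus_in q_uminus)

lemma q_sum: "(\<And>i. i \<in> I \<Longrightarrow> f i \<in> R) \<Longrightarrow> q (sum f I) \<le> (\<Sum>i\<in>I. q (f i))"
proof (induction I rule: infinite_finite_induct)
  case (insert i I)
  then show ?case
    using q_add[of "f i" "sum f I"] by (fastforce intro: sum_in)
qed (simp_all add: q_zero)

lemma q_power: "a \<in> R \<Longrightarrow> q (a ^ n) \<le> q a ^ n"
proof (induction n)
  case (Suc n)
  then show ?case
    using q_mult[of a "a ^ n"] mult_left_mono[OF Suc.IH q_nonneg[of a]]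
    by (simp add: closed_under)
qed (simp add: q_one_le)

lemma q_null_mult: "m \<in> R \<Longrightarrow> a \<in> R \<Longrightarrow> q m = 0 \<Longrightarrow> q (m * a) = 0"
  using q_mult[of m a] q_nonneg[of "m * a"] by simp

lemma q_le_null: "a \<in> R \<Longrightarrow> b \<in> R \<Longrightarrow> q (a - b) = 0 \<Longrightarrow> q a \<le> q b"
  using q_add[of "a - b" b] by (simp add: closed_under)

text \<open>
  Rickart's proof that the spectrum is not empty. If every \<open>f - c \<mu>\<close> is invertible, then the
  inverse \<open>H z\<close> of \<open>1 - z f\<close> is Lipschitz on every disc, and its average over the circle of radius
  \<open>r\<close> at the \<open>n\<close>-th roots of unity is the inverse of \<open>1 - r\<^sup>n f\<^sup>n\<close>. So \<open>r\<^sup>n f\<^sup>n \<rightarrow> 0\<close>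
  propagates from \<open>r\<close> to \<open>r + \<delta>\<close> with \<open>\<delta>\<close> depending only on the disc, and hence holds for all
  \<open>r\<close>, which is absurd as \<open>f\<close> is invertible.
\<close>

lemma exists_spectral_value:
  assumes f: "f \<in> R" and "q 1 \<noteq> 0"
  shows "\<exists>\<mu>. \<forall>g\<in>R. q (g * (f - c \<mu>) - 1) \<noteq> 0"
proof (rule ccontr)
  assume "\<not> ?thesis"
  then have inv: "\<exists>g\<in>R. q (g * (f - c \<mu>) - 1) = 0" for \<mu>
    by blast
  have q1: "0 < q 1"
    using assms(2) q_nonneg[of 1] by simp
  \<comment> \<open>For z \<noteq> 0 one has 1 - z f = -z (f - 1/z), so an inverse of f - 1/z gives
    one of 1 - z f.\<close>
  have "\<exists>h\<in>R. q (h * (1 - c z * f) - 1) = 0" for z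
  proof (cases "z = 0")
    case True
    then show ?thesis
      by (intro bexI[of _ 1]) (simp_all add: c_zero q_zero one_in)
  next
    case False
    obtain g where g: "g \<in> R" "q (g * (f - c (1 / z)) - 1) = 0"
      using inv by blast
    have "c (1 / z) * c z = 1"
      using False c_mult[of "1 / z" z] by (simp add: c_one)
    moreover have "- c (1 / z) * g * (1 - c z * f) = g * ((c (1 / z) * c z) * f - c (1 / z))"
      by (simp add: algebra_simps)
    ultimately have "- c (1 / z) * g * (1 - c z * f) = g * (f - c (1 / z))"
      by simp
    with g show ?thesis
      by (intro bexI[of _ "- c (1 / z) * g"]) (simp_all add: closed_under)
  qed
  then obtain H where H: "H z \<in> R" and H_null: "q (H z * (1 - c z * f) - 1) = 0" for z
    by metis
  note in_R = closed_under f H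
  \<comment> \<open>An element invertible modulo null elements is not null, since
    \<open>q 1 \<le> q a * q b\<close>.\<close>
  have q_unit: "0 < q a" if "a \<in> R" "b \<in> R" "q (a * b - 1) = 0" for a b
  proof -
    have "q 1 \<le> q (a * b)"
      using that q_le_null[of 1 "a * b"] q_uminus[of "a * b - 1"] by (simp add: in_R)
    also have "\<dots> \<le> q a * q b"
      using that q_mult by blast
    finally have "0 < q a * q b" using q1 by linarith
    then show ?thesis
      using q_nonneg[of a] by (cases "q a = 0") auto
  qed
  have H_pos: "0 < q (H z)" for z
    by (rule q_unit[OF _ _ H_null]) (simp_all add: in_R)
  \<comment> \<open>The resolvent identity: H(z) - H(w) is (z - w) f H(z) H(w) up to a null element
    formed from the defects \<open>m\<close> and \<open>n\<close> of the two inverses.\<close>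
  have H_diff: "q (H z - H w) \<le> cmod (z - w) * q f * q (H z) * q (H w)" for z w
  proof -
    define m n where "m = H z * (1 - c z * f) - 1" and "n = H w * (1 - c w * f) - 1"
    have mn: "m \<in> R" "n \<in> R" "q m = 0" "q n = 0"
      using H_null by (simp_all add: m_def n_def in_R)
    let ?a = "c (z - w) * f * H z * H w"
    have "H z - H w = ?a + (m * H w - n * H z)"
      by (simp add: m_def n_def c_diff algebra_simps)
    moreover have "q (m * H w - n * H z) = 0"
      using q_diff[of "m * H w" "n * H z"] mn q_nonneg[of "m * H w - n * H z"]
      by (simp add: in_R q_null_mult)
    ultimately have "q (H z - H w) \<le> q ?a"
      using q_le_null[of "H z - H w" ?a] mn by (simp add: in_R)
    also have "\<dots> \<le> q (c (z - w) * f * H z) * q (H w)"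
      by (intro q_mult in_R)
    also have "q (c (z - w) * f * H z) \<le> q (c (z - w) * f) * q (H z)"
      by (intro q_mult in_R)
    also have "q (c (z - w) * f) \<le> q (c (z - w)) * q f"
      by (intro q_mult in_R)
    also have "q (c (z - w)) \<le> cmod (z - w)"
      by (rule q_c)
    finally show ?thesis
      by (simp add: q_nonneg mult_right_mono)
  qed
  \<comment> \<open>Dividing the estimate for \<open>H\<close> by \<open>q (H z) * q (H w)\<close>
    makes \<open>u\<close> Lipschitz without any prior bound on \<open>H\<close>. Its positive
    minimum on a compact disc then bounds \<open>H\<close> there.\<close>
  define u where "u z = 1 / q (H z)" for z
  have u_le: "u w - u z \<le> q f * cmod (z - w)" for z w
  proof -
    have "q (H z) - q (H w) \<le> q (H z - H w)"
      using q_add[of "H z - H w" "H w"] by (simp add: in_R)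
    with H_diff[of z w] have "q (H z) - q (H w) \<le> cmod (z - w) * q f * q (H z) * q (H w)"
      by linarith
    then show ?thesis
      using H_pos[of z] H_pos[of w] by (simp add: u_def field_simps)
  qed
  have "(q f)-lipschitz_on UNIV u"
  proof (rule lipschitz_onI)
    show "dist (u z) (u w) \<le> q f * dist z w" for z w
      using u_le[of z w] u_le[of w z] by (simp add: dist_norm abs_le_iff norm_minus_commute)
  qed (rule q_nonneg)
  then have u_cont: "continuous_on S u" for S
    using lipschitz_on_continuous_on lipschitz_on_subset by blast
  \<comment> \<open>\<open>g\<close> inverts \<open>f\<close>, so \<open>(g * f) ^ n\<close> is 1
    modulo null elements and \<open>r0 ^ n * q (f ^ n)\<close> stays above \<open>q 1\<close>. The
    estimates are made on the disc of radius \<open>2 * r0\<close> because the propagation step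
    looks ahead beyond the radius it reaches.\<close>
  obtain g where g: "g \<in> R" "q (g * f - 1) = 0"
    using inv[of 0] by (auto simp: c_zero)
  define r0 where "r0 = q g"
  have r0: "0 < r0"
    unfolding r0_def using g f by (intro q_unit)
  obtain C where C: "\<And>z. cmod z \<le> 2 * r0 \<Longrightarrow> q (H z) \<le> C"
  proof -
    obtain z0 where "\<forall>z\<in>cball 0 (2 * r0). u z0 \<le> u z"
      using continuous_attains_inf[OF compact_cball _ u_cont, of 0 "2 * r0"] r0 by auto
    then have "q (H z) \<le> q (H z0)" if "cmod z \<le> 2 * r0" for z
    proof -
      have "u z0 \<le> u z"
        using that \<open>\<forall>z\<in>_. _\<close> by simp
      then show ?thesis
        using H_pos[of z] H_pos[of z0] by (simp add: u_def field_simps)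
    qed
    then show ?thesis using that by blast
  qed
  define L where "L = q f * C * C"
  have C_nonneg: "0 \<le> C"
    using C[of 0] q_nonneg[of "H 0"] r0 by simp
  have H_lip: "q (H z - H w) \<le> cmod (z - w) * L" if "cmod z \<le> 2 * r0" "cmod w \<le> 2 * r0" for z w
  proof -
    have "q (H z) * q (H w) \<le> C * C"
      using that C C_nonneg by (intro mult_mono) (auto simp: q_nonneg)
    then have "(cmod (z - w) * q f) * (q (H z) * q (H w)) \<le> (cmod (z - w) * q f) * (C * C)"
      by (rule mult_left_mono) (simp add: q_nonneg)
    with H_diff[of z w] show ?thesis
      by (simp add: L_def mult_ac)
  qed
  define K where
    "K n r = c (1 / of_nat n) * (\<Sum>j<n. H (of_real r * cis (2 * pi / n) ^ j))" for n :: nat and r :: real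
  have K_in: "K n r \<in> R" for n r
    unfolding K_def by (intro in_R)
  \<comment> \<open>Since r^n f^n = (w_j f)^n, multiplying \<open>H (w j)\<close> by 1 - r^n f^n
    leaves the geometric sum \<open>P j\<close> modulo null elements. In the sum over j the positive
    powers cancel by \<open>sum_cis_powers\<close>, and the constant terms add up to n.\<close>
  have K_null: "q (K n r * (1 - c (of_real r ^ n) * f ^ n) - 1) = 0" if n: "n > 0" for n r
  proof -
    define w where "w j = of_real r * cis (2 * pi / n) ^ j" for j
    define m where "m j = H (w j) * (1 - c (w j) * f) - 1" for j
    define P where "P j = (\<Sum>k<n. (c (w j) * f) ^ k)" for j
    have mP: "m j \<in> R" "P j \<in> R" "q (m j) = 0" for j
      unfolding m_def P_def using H_null by (simp_all add: in_R)
    have w_n: "w j ^ n = of_real r ^ n" for j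
    proof -
      have "cis (2 * pi / n) ^ n = 1"
        using n by (simp add: Complex.DeMoivre)
      then show ?thesis
        by (metis (no_types) mult.commute mult.right_neutral power_mult power_mult_distrib power_one w_def)
    qed
    have eq: "H (w j) * (1 - c (of_real r ^ n) * f ^ n) = P j + m j * P j" for j
    proof -
      have P_eq: "1 - c (of_real r ^ n) * f ^ n = (1 - c (w j) * f) * P j"
        unfolding P_def one_diff_power_eq[symmetric]
        by (simp add: power_mult_distrib w_n flip: c_power)
      have "H (w j) * (1 - c (w j) * f) = 1 + m j"
        by (simp add: m_def)
      then show ?thesis
        unfolding P_eq mult.assoc[symmetric] by (simp add: distrib_right)
    qed
    have P_sum: "(\<Sum>j<n. P j) = c (of_nat n)"
    proof -
      have "(\<Sum>j<n. P j) = (\<Sum>k<n. (\<Sum>j<n. c (w j ^ k)) * f ^ k)"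
        unfolding P_def sum_distrib_right
        by (subst sum.swap) (simp add: power_mult_distrib c_power)
      also have "\<dots> = (\<Sum>k<n. if k = 0 then c (of_nat n) else 0)"
      proof (rule sum.cong[OF refl])
        fix k assume k: "k \<in> {..<n}"
        have "(\<Sum>j<n. w j ^ k) = of_real r ^ k * (\<Sum>j<n. cis (2 * pi / n) ^ (j * k))"
          by (simp add: w_def power_mult_distrib power_mult sum_distrib_left)
        also have "\<dots> = (if k = 0 then of_nat n else 0)"
          using sum_cis_powers[of k n] k by simp
        finally show "(\<Sum>j<n. c (w j ^ k)) * f ^ k = (if k = 0 then c (of_nat n) else 0)"
          by (simp add: c_zero flip: c_sum)
      qed
      also have "\<dots> = c (of_nat n)"
        using n by simp
      finally show ?thesis .
    qed
    have "K n r * (1 - c (of_real r ^ n) * f ^ n)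
        = c (1 / of_nat n) * (\<Sum>j<n. H (w j) * (1 - c (of_real r ^ n) * f ^ n))"
      by (simp add: K_def w_def sum_distrib_right mult.assoc)
    also have "\<dots> = c (1 / of_nat n) * c (of_nat n) + c (1 / of_nat n) * (\<Sum>j<n. m j * P j)"
      by (simp add: eq sum.distrib P_sum distrib_left)
    also have "c (1 / of_nat n) * c (of_nat n) = 1"
      using n by (simp add: c_one flip: c_mult)
    finally have *: "K n r * (1 - c (of_real r ^ n) * f ^ n) - 1 = (\<Sum>j<n. m j * P j) * c (1 / of_nat n)"
      by (simp add: mult.commute)
    have "q (\<Sum>j<n. m j * P j) = 0"
      using q_sum[of "{..<n}" "\<lambda>j. m j * P j"] q_nonneg[of "\<Sum>j<n. m j * P j"] mP
      by (simp add: q_null_mult in_R)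
    then show ?thesis
      unfolding * by (intro q_null_mult in_R mP)
  qed
  \<comment> \<open>Corresponding nodes on the two circles have distance
    \<open>\<bar>r - r'\<bar>\<close>, so the averages inherit the constant \<open>L\<close> of
    \<open>H\<close>, uniformly in n.\<close>
  have K_lip: "q (K n r - K n r') \<le> \<bar>r - r'\<bar> * L"
    if n: "n > 0" and r: "0 \<le> r" "r \<le> 2 * r0" "0 \<le> r'" "r' \<le> 2 * r0" for n r r'
  proof -
    define z where "z x j = of_real x * cis (2 * pi / n) ^ j" for x j
    have z: "cmod (z x j) = \<bar>x\<bar>" for x j
      by (simp add: z_def norm_mult norm_power)
    have "cmod (z r j - z r' j) = \<bar>r - r'\<bar>" for j
    proof -
      have "z r j - z r' j = z (r - r') j"
        by (simp add: z_def algebra_simps)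
      then show ?thesis by (simp add: z)
    qed
    then have le: "q (H (z r j) - H (z r' j)) \<le> \<bar>r - r'\<bar> * L" for j
      using H_lip[of "z r j" "z r' j"] r by (simp add: z)
    have "K n r - K n r' = c (1 / of_nat n) * (\<Sum>j<n. H (z r j) - H (z r' j))"
      by (simp add: K_def z_def sum_subtractf right_diff_distrib)
    then have "q (K n r - K n r') \<le> q (c (1 / of_nat n)) * q (\<Sum>j<n. H (z r j) - H (z r' j))"
      using q_mult by (simp add: in_R)
    also have "\<dots> \<le> (1 / n) * (\<Sum>j<n. q (H (z r j) - H (z r' j)))"
      using q_c[of "1 / of_nat n"] by (intro mult_mono q_sum in_R) (simp_all add: q_nonneg norm_divide)
    also have "\<dots> \<le> (1 / n) * (\<Sum>j<n. \<bar>r - r'\<bar> * L)"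
      by (intro mult_left_mono sum_mono le) simp
    finally show ?thesis using n by simp
  qed
  define Z where "Z r \<longleftrightarrow> (\<lambda>n. r ^ n * q (f ^ n)) \<longlonglongrightarrow> 0" for r :: real
  have e_le: "q (c (of_real r ^ n) * f ^ n) \<le> r ^ n * q (f ^ n)" if "0 \<le> r" for r n
    using q_mult[of "c (of_real r ^ n)" "f ^ n"] q_c[of "of_real r ^ n"] that
      mult_right_mono[OF q_c[of "of_real r ^ n"] q_nonneg[of "f ^ n"]]
    by (simp add: in_R norm_power)
  \<comment> \<open>For large n, \<open>q e \<le> 1/5\<close> puts \<open>K n r\<close> within 1/4
    of 1, as x \<le> x/5 + 1/5 means x \<le> 1/4. Passing to the radius \<open>s\<close> costs at
    most another 1/4, which gives \<open>q a \<le> 2\<close> and the bound 3 for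
    \<open>s ^ n * q (f ^ n)\<close>. Boundedness at \<open>s\<close> implies decay at the smaller
    radius \<open>r + \<delta>\<close>.\<close>
  have step: "Z (r + \<delta>)" if Z: "Z r" and \<delta>: "0 < \<delta>" "2 * \<delta> * L \<le> 1/4" and r: "0 \<le> r" "r + 2 * \<delta> \<le> 2 * r0"
    for r \<delta>
  proof -
    define s where "s = r + 2 * \<delta>"
    have "\<forall>\<^sub>F n in sequentially. r ^ n * q (f ^ n) < 1/5"
      using Z unfolding Z_def by (rule order_tendstoD) simp
    moreover have "\<forall>\<^sub>F n in sequentially. n > 0"
      by (rule eventually_gt_at_top)
    ultimately have bound: "\<forall>\<^sub>F n in sequentially. s ^ n * q (f ^ n) \<le> 3"
    proof eventually_elim
      case (elim n)
      define e where "e = c (of_real r ^ n) * f ^ n"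
      define a where "a = 1 - c (of_real s ^ n) * f ^ n"
      have ea: "e \<in> R" "a \<in> R"
        by (simp_all add: e_def a_def in_R)
      have qe: "q e \<le> 1/5"
        using e_le[of r n] elim r by (simp add: e_def)
      have K1: "q (K n r - 1) \<le> 1/4"
      proof -
        let ?k = "K n r - 1"
        have null: "q (?k - (?k * e + e)) = 0"
        proof -
          have eq: "?k - (?k * e + e) = K n r * (1 - e) - 1"
            by (simp add: algebra_simps)
          show ?thesis
            unfolding eq using K_null[of n r] elim by (simp add: e_def)
        qed
        have k: "?k \<in> R" by (intro in_R K_in)
        have "q ?k \<le> q (?k * e + e)"
          using null k ea K_in by (intro q_le_null in_R)
        also have "\<dots> \<le> q (?k * e) + q e"
          using k ea K_in by (intro q_add in_R)
        also have "q (?k * e) \<le> q ?k * q e"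
          using k ea K_in by (intro q_mult)
        also have "q ?k * q e \<le> q ?k * (1/5)"
          by (intro mult_left_mono qe q_nonneg)
        finally show ?thesis using qe by simp
      qed
      have "q (K n s - K n r) \<le> \<bar>s - r\<bar> * L"
        using elim \<delta> r by (intro K_lip) (auto simp: s_def)
      also have "\<dots> \<le> 1/4" using \<delta> by (simp add: s_def)
      finally have "q (K n s - 1) \<le> 1/2"
        using K1 q_add[of "K n s - K n r" "K n r - 1"] by (simp add: in_R K_in)
      then have K2: "q (1 - K n s) \<le> 1/2"
        using q_uminus[of "K n s - 1"] by (simp add: in_R K_in)
      have "q (a - (a * (1 - K n s) + 1)) = 0"
      proof -
        have eq: "a - (a * (1 - K n s) + 1) = K n s * a - 1"
          by (simp add: algebra_simps)
        show ?thesis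
          unfolding eq using K_null[of n s] elim by (simp add: a_def)
      qed
      then have "q a \<le> q (a * (1 - K n s) + 1)"
        using ea K_in by (intro q_le_null in_R)
      also have "\<dots> \<le> q (a * (1 - K n s)) + q 1"
        using ea K_in by (intro q_add in_R)
      also have "q (a * (1 - K n s)) \<le> q a * q (1 - K n s)"
        using ea K_in by (intro q_mult in_R)
      also have "q a * q (1 - K n s) \<le> q a * (1/2)"
        by (intro mult_left_mono K2 q_nonneg)
      finally have qa: "q a \<le> 2" using q_one_le by simp
      have s: "0 < s" using r \<delta> by (simp add: s_def)
      have "f ^ n = c (inverse (of_real s ^ n)) * (1 - a)"
      proof -
        have "c (inverse (of_real s ^ n)) * c (of_real s ^ n) = 1"
          using s by (simp add: c_one flip: c_mult)
        then show ?thesis by (simp add: a_def mult.assoc[symmetric])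
      qed
      then have "q (f ^ n) \<le> q (c (inverse (of_real s ^ n))) * q (1 - a)"
        using q_mult ea by (simp add: in_R)
      also have "\<dots> \<le> inverse (s ^ n) * 3"
        using q_c[of "inverse (of_real s ^ n)"] q_diff[of 1 a] qa q_one_le ea s
        by (intro mult_mono) (auto simp: q_nonneg in_R norm_inverse norm_power)
      finally show ?case using s by (simp add: field_simps)
    qed
    have lim: "(\<lambda>n. 3 * ((r + \<delta>) / s) ^ n) \<longlonglongrightarrow> 0"
      using r \<delta> by (intro tendsto_mult_right_zero LIMSEQ_power_zero) (simp add: s_def)
    show ?thesis
      unfolding Z_def
    proof (rule Lim_null_comparison[OF _ lim])
      from bound show "\<forall>\<^sub>F n in sequentially. norm ((r + \<delta>) ^ n * q (f ^ n)) \<le> 3 * ((r + \<delta>) / s) ^ n"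
      proof eventually_elim
        case (elim n)
        have "0 < s" using r \<delta> by (simp add: s_def)
        then have "(r + \<delta>) ^ n * q (f ^ n) = ((r + \<delta>) / s) ^ n * (s ^ n * q (f ^ n))"
          by (simp add: power_divide)
        also have "\<dots> \<le> ((r + \<delta>) / s) ^ n * 3"
          using elim r \<delta> \<open>0 < s\<close> by (intro mult_left_mono) auto
        finally show ?case
          using r \<delta> by (simp add: q_nonneg mult.commute)
      qed
    qed
  qed
  \<comment> \<open>For \<open>\<delta> = r0 / N\<close> the second condition says
    \<open>2 * \<delta> * L \<le> 1/4\<close>; N steps of length \<delta> lead from 0 to
    \<open>r0\<close>.\<close>
  obtain N :: nat where N: "N > 0" "8 * r0 * L \<le> N"
    using reals_Archimedean2[of "max 1 (8 * r0 * L)"] by (metis gr0I less_eq_real_def max_less_iff_conj not_one_less_zero of_nat_0)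
  define \<delta> where "\<delta> = r0 / N"
  have "Z (real k * \<delta>)" if "k \<le> N" for k
    using that
  proof (induction k)
    case 0
    \<comment> \<open>The index 0 is excluded because \<open>0 ^ 0 = 1\<close>.\<close>
    have "\<forall>\<^sub>F n in sequentially. (0::real) ^ n * q (f ^ n) = 0"
      using eventually_gt_at_top[of 0] by eventually_elim simp
    then show ?case
      unfolding Z_def by (simp add: tendsto_eventually)
  next
    case (Suc k)
    have "real k * \<delta> + 2 * \<delta> = (real k + 2) / N * r0"
      by (simp add: \<delta>_def add_divide_distrib algebra_simps)
    also have "\<dots> \<le> 2 * r0"
    proof (intro mult_right_mono)
      show "(real k + 2) / real N \<le> 2"
        using N(1) Suc.prems by (simp add: field_simps)
    qed (use r0 in simp)
    finally have le: "real k * \<delta> + 2 * \<delta> \<le> 2 * r0" .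
    have "Z (real k * \<delta> + \<delta>)"
    proof (rule step)
      show "2 * \<delta> * L \<le> 1 / 4"
        using N by (simp add: \<delta>_def field_simps)
    qed (use Suc r0 N(1) le in \<open>auto simp: \<delta>_def\<close>)
    then show ?case by (simp add: algebra_simps)
  qed
  from this[of N] have "Z r0" using N by (simp add: \<delta>_def)
  moreover have "q 1 \<le> r0 ^ n * q (f ^ n)" for n
  proof -
    have "q ((g * f) ^ n - 1) = 0"
      unfolding power_diff_1_eq using g by (intro q_null_mult in_R) auto
    then have "q 1 \<le> q ((g * f) ^ n)"
      using q_le_null[of 1 "(g * f) ^ n"] q_uminus[of "(g * f) ^ n - 1"] g by (simp add: in_R)
    also have "\<dots> \<le> q (g ^ n) * q (f ^ n)"
      unfolding power_mult_distrib using g by (intro q_mult in_R)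
    also have "\<dots> \<le> r0 ^ n * q (f ^ n)"
      unfolding r0_def using g by (intro mult_right_mono q_power q_nonneg)
    finally show ?thesis .
  qed
  ultimately have "q 1 \<le> 0"
    unfolding Z_def by (intro LIMSEQ_le_const) auto
  then show False using q1 by simp
qed

end

section \<open>Quotient seminorms, maximal ideals and the Gelfand-Mazur argument\<close>

lemma infdist_greatest:
  assumes "M \<noteq> {}" "\<And>m. m \<in> M \<Longrightarrow> b \<le> dist a m"
  shows "b \<le> infdist a M"
  using assms by (simp add: infdist_notempty cINF_greatest)

definition ideal_of :: "'a::comm_ring_1 set \<Rightarrow> 'a set \<Rightarrow> bool" where
  "ideal_of R I \<longleftrightarrow> I \<subseteq> R \<and> 0 \<in> I \<and> (\<forall>a\<in>I. \<forall>b\<in>I. a + b \<in> I) \<and> (\<forall>a\<in>R. \<forall>b\<in>I. a * b \<in> I)"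

lemma (in unital_subalgebra) ideal_diff:
  assumes "ideal_of R I" "a \<in> I" "b \<in> I"
  shows "a - b \<in> I"
proof -
  have "- 1 * b \<in> I"
    using assms closed_under(5,6) unfolding ideal_of_def by blast
  then have "a + - 1 * b \<in> I"
    using assms unfolding ideal_of_def by blast
  then show ?thesis by simp
qed

text \<open>Approximating sequences are combined termwise; \<open>op\<close> will be addition or
  multiplication.\<close>

lemma closure_binop:
  fixes op :: "'a::metric_space \<Rightarrow> 'b::metric_space \<Rightarrow> 'c::metric_space"
  assumes "\<And>a b. a \<in> I \<Longrightarrow> b \<in> J \<Longrightarrow> op a b \<in> K" and "a \<in> closure I" "b \<in> closure J"
    and op: "\<And>x y. x \<longlonglongrightarrow> a \<Longrightarrow> y \<longlonglongrightarrow> b \<Longrightarrow> (\<lambda>n. op (x n) (y n)) \<longlonglongrightarrow> op a b"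
  shows "op a b \<in> closure K"
proof -
  obtain x y where "\<And>n. x n \<in> I" "x \<longlonglongrightarrow> a" "\<And>n. y n \<in> J" "y \<longlonglongrightarrow> b"
    using assms(2,3) unfolding closure_sequential by blast
  then show ?thesis
    unfolding closure_sequential using assms(1) op by (intro exI[of _ "\<lambda>n. op (x n) (y n)"]) simp
qed

locale closed_subalgebra = unital_subalgebra R c
  for R :: "'a::{real_normed_algebra_1, comm_ring_1, banach} set" and c :: "complex \<Rightarrow> 'a" +
  assumes closed_R: "closed R"
    and norm_c: "norm (c z) \<le> cmod z"
begin

text \<open>The inverse is the Neumann series in \<open>1 - u\<close>; its partial sums lie in
  \<open>R\<close>, and so does its limit because \<open>R\<close> is closed.\<close>

lemma unit_if_near_one:
  assumes u: "u \<in> R" "norm (1 - u) < 1"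
  shows "\<exists>v\<in>R. v * u = 1"
proof -
  let ?w = "1 - u"
  define v where "v = (\<Sum>n. ?w ^ n)"
  have sums: "(\<lambda>n. ?w ^ n) sums v"
    unfolding v_def using complete_algebra_summable_geometric[OF u(2)] by (rule summable_sums)
  have "v \<in> R"
    using closed_sequentially[OF closed_R _ sums[unfolded sums_def]] u(1) by (simp add: closed_under)
  have "(\<lambda>n. (\<Sum>i<n. ?w ^ i) * u) \<longlonglongrightarrow> v * u"
    using sums unfolding sums_def by (intro tendsto_intros)
  moreover have "(\<Sum>i<n. ?w ^ i) * u = 1 - ?w ^ n" for n
    using one_diff_power_eq[of ?w n] by (simp add: mult.commute)
  moreover have "(\<lambda>n. 1 - ?w ^ n) \<longlonglongrightarrow> 1 - 0"
    using u(2) by (intro tendsto_diff tendsto_const LIMSEQ_power_zero)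
  ultimately have "v * u = 1"
    using LIMSEQ_unique by fastforce
  with \<open>v \<in> R\<close> show ?thesis by blast
qed

text \<open>The distance to \<open>M\<close> is the quotient seminorm of R/M: an infimum over the
  representatives a - m of a residue class.\<close>

lemma seminormed_algebra_infdist:
  assumes M: "ideal_of R M"
  shows "seminormed_algebra R c (\<lambda>a. infdist a M)"
proof
  have M_in: "m \<in> R" if "m \<in> M" for m
    using M that by (auto simp: ideal_of_def)
  have M_add: "m + n \<in> M" if "m \<in> M" "n \<in> M" for m n
    using M that by (auto simp: ideal_of_def)
  have M_mult: "m * a \<in> M" "a * m \<in> M" if "m \<in> M" "a \<in> R" for m a
    using M that by (auto simp: ideal_of_def mult.commute)
  have ne: "M \<noteq> {}" using M by (auto simp: ideal_of_def)
  show "0 \<le> infdist a M" for a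
    by (rule infdist_nonneg)
  show "infdist (c z) M \<le> cmod z" for z
    using infdist_le[of 0 M "c z"] norm_c[of z] M by (simp add: ideal_of_def)
  fix a b assume ab: "a \<in> R" "b \<in> R"
  have "infdist (a + b) M - infdist b M \<le> infdist a M"
  proof (rule infdist_greatest[OF ne])
    fix m assume m: "m \<in> M"
    have "infdist (a + b) M - dist a m \<le> infdist b M"
    proof (rule infdist_greatest[OF ne])
      fix n assume n: "n \<in> M"
      have "infdist (a + b) M \<le> dist (a + b) (m + n)"
        using m n by (intro infdist_le M_add)
      also have "\<dots> \<le> dist a m + dist b n"
        by (rule dist_triangle_add)
      finally show "infdist (a + b) M - dist a m \<le> dist b n" by simp
    qed
    then show "infdist (a + b) M - infdist b M \<le> dist a m" by simp
  qed
  then show "infdist (a + b) M \<le> infdist a M + infdist b M" by simp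
  \<comment> \<open>(a - m)(b - n) represents the class of ab, the difference being the element m(b
    - n) + an of \<open>M\<close>.\<close>
  have le: "infdist (a * b) M \<le> dist a m * dist b n" if m: "m \<in> M" and n: "n \<in> M" for m n
  proof -
    have "infdist (a * b) M \<le> dist (a * b) (m * (b - n) + a * n)"
      using m n ab M_in by (intro infdist_le M_add M_mult closed_under)
    also have "\<dots> = norm ((a - m) * (b - n))"
      by (simp add: dist_norm algebra_simps)
    also have "\<dots> \<le> dist a m * dist b n"
      unfolding dist_norm by (rule norm_mult_ineq)
    finally show ?thesis .
  qed
  \<comment> \<open>The infimum is taken in one factor at a time, the other being the fixed number
    \<open>k\<close>; dividing by \<open>k\<close> requires a separate case for 0.\<close>
  have le_infdist: "x \<le> k * infdist a M" if "0 \<le> k" "\<And>m. m \<in> M \<Longrightarrow> x \<le> k * dist a m" for x k :: real and a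
  proof (cases "k = 0")
    case True
    then show ?thesis using that(2) ne by auto
  next
    case False
    then have "x / k \<le> infdist a M"
      using that by (intro infdist_greatest ne) (simp add: field_simps)
    then show ?thesis using False that(1) by (simp add: field_simps)
  qed
  show "infdist (a * b) M \<le> infdist a M * infdist b M"
  proof (intro le_infdist infdist_nonneg)
    fix n assume "n \<in> M"
    then have "infdist (a * b) M \<le> dist b n * infdist a M"
      by (intro le_infdist) (auto simp: mult.commute intro: le)
    then show "infdist (a * b) M \<le> infdist a M * dist b n"
      by (simp add: mult.commute)
  qed
qed

text \<open>Zorn's lemma applies: any two elements of the union of a chain lie in a common member,
  so the union is an ideal, and it omits 1 because every member does.\<close>

lemma exists_maximal_ideal:
  assumes "ideal_of R I" "1 \<notin> I"
  obtains M where "ideal_of R M" "1 \<notin> M" "I \<subseteq> M"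
    "\<And>J. ideal_of R J \<Longrightarrow> 1 \<notin> J \<Longrightarrow> M \<subseteq> J \<Longrightarrow> J = M"
proof -
  let ?P = "{J. ideal_of R J \<and> 1 \<notin> J \<and> I \<subseteq> J}"
  have "\<exists>M\<in>?P. \<forall>X\<in>?P. M \<subseteq> X \<longrightarrow> X = M"
  proof (rule subset_Zorn_nonempty)
    show "?P \<noteq> {}" using assms by blast
    fix C assume ne: "C \<noteq> {}" and C: "subset.chain ?P C"
    then have sub: "C \<subseteq> ?P" and tot: "\<And>J K. J \<in> C \<Longrightarrow> K \<in> C \<Longrightarrow> J \<subseteq> K \<or> K \<subseteq> J"
      unfolding subset.chain_def by blast+
    have ideal: "ideal_of R J" and proper: "1 \<notin> J" and I_sub: "I \<subseteq> J" if "J \<in> C" for J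
      using sub that by blast+
    have "a + b \<in> \<Union>C" if ab: "a \<in> \<Union>C" "b \<in> \<Union>C" for a b
    proof -
      obtain J where J: "J \<in> C" "a \<in> J" "b \<in> J"
        using ab tot by blast
      then have "a + b \<in> J"
        using ideal[of J] unfolding ideal_of_def by blast
      with J show ?thesis by blast
    qed
    moreover have "a * b \<in> \<Union>C" if ab: "a \<in> R" "b \<in> \<Union>C" for a b
    proof -
      obtain J where J: "J \<in> C" "b \<in> J"
        using ab by blast
      then have "a * b \<in> J"
        using ideal[of J] ab unfolding ideal_of_def by blast
      with J show ?thesis by blast
    qed
    moreover have "\<Union>C \<subseteq> R"
      using ideal unfolding ideal_of_def by blast
    moreover obtain J where J: "J \<in> C" using ne by blast
    moreover have "0 \<in> J"
      using ideal[OF J] unfolding ideal_of_def by blast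
    ultimately have "ideal_of R (\<Union>C)"
      unfolding ideal_of_def by blast
    then show "\<Union>C \<in> ?P"
      using proper I_sub J by blast
  qed
  then obtain M where M: "M \<in> ?P" and max: "\<And>X. X \<in> ?P \<Longrightarrow> M \<subseteq> X \<Longrightarrow> X = M"
    by auto
  show ?thesis
  proof (rule that)
    show "J = M" if "ideal_of R J" "1 \<notin> J" "M \<subseteq> J" for J
      using that M by (intro max) auto
  qed (use M in auto)
qed

text \<open>Modulo a maximal ideal \<open>M\<close> containing \<open>I\<close> every element is a
  scalar, as in the Gelfand-Mazur theorem; \<psi> reads off this scalar.\<close>

lemma exists_character:
  assumes I: "ideal_of R I" "1 \<notin> I"
  obtains \<psi> where "\<And>a b. a \<in> R \<Longrightarrow> b \<in> R \<Longrightarrow> \<psi> (a + b) = \<psi> a + \<psi> b"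
    "\<And>a b. a \<in> R \<Longrightarrow> b \<in> R \<Longrightarrow> \<psi> (a * b) = \<psi> a * \<psi> b"
    "\<And>z. \<psi> (c z) = z" "\<And>a. a \<in> I \<Longrightarrow> \<psi> a = (0 :: complex)"
proof -
  obtain M where M: "ideal_of R M" and M1: "1 \<notin> M" and IM: "I \<subseteq> M"
    and M_max: "\<And>J. ideal_of R J \<Longrightarrow> 1 \<notin> J \<Longrightarrow> M \<subseteq> J \<Longrightarrow> J = M"
    using exists_maximal_ideal[OF I] by metis
  have M0: "0 \<in> M" and M_sub: "M \<subseteq> R"
    and M_add: "\<And>m n. m \<in> M \<Longrightarrow> n \<in> M \<Longrightarrow> m + n \<in> M"
    and M_mult: "\<And>a m. a \<in> R \<Longrightarrow> m \<in> M \<Longrightarrow> a * m \<in> M"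
    using M by (auto simp: ideal_of_def)
  interpret seminormed_algebra R c "\<lambda>a. infdist a M"
    by (rule seminormed_algebra_infdist[OF M])
  \<comment> \<open>Elements of \<open>R\<close> at distance less than 1 from 1 are units, and a
    proper ideal contains no unit.\<close>
  have "1 \<le> infdist 1 M"
  proof (rule infdist_greatest)
    show "1 \<le> dist 1 m" if m: "m \<in> M" for m
    proof (rule ccontr)
      assume "\<not> 1 \<le> dist 1 m"
      then obtain v where "v \<in> R" "v * m = 1"
        using unit_if_near_one[of m] m M_sub by (auto simp: dist_norm)
      then show False using M_mult[of v m] m M1 by simp
    qed
  qed (use M0 in blast)
  then have q1: "infdist 1 M \<noteq> 0" by linarith
  have spec: "\<exists>\<mu>. f - c \<mu> \<in> M" if f: "f \<in> R" for f
  proof -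
    obtain \<mu> where \<mu>: "\<And>g. g \<in> R \<Longrightarrow> infdist (g * (f - c \<mu>) - 1) M \<noteq> 0"
      using exists_spectral_value[OF f q1] by blast
    \<comment> \<open>\<open>J\<close> is the ideal generated by \<open>M\<close> and
      \<open>f - c \<mu>\<close>. Were 1 in it, \<open>f - c \<mu>\<close> would be invertible
      modulo \<open>M\<close>, against the choice of \<mu>; so maximality gives
      \<open>J = M\<close>, and \<open>f - c \<mu>\<close> lies in \<open>M\<close>.\<close>
    define J where "J = {m + g * (f - c \<mu>) | m g. m \<in> M \<and> g \<in> R}"
    have f\<mu>: "f - c \<mu> \<in> R" using f by (simp add: closed_under)
    have MJ: "M \<subseteq> J"
    proof
      fix m assume "m \<in> M"
      then have "m + 0 * (f - c \<mu>) \<in> J" unfolding J_def using zero_in by blast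
      then show "m \<in> J" by simp
    qed
    have "ideal_of R J"
      unfolding ideal_of_def
    proof (intro conjI ballI)
      show "J \<subseteq> R"
        using M_sub f\<mu> by (auto simp: J_def intro!: closed_under)
      show "0 \<in> J" using MJ M0 by blast
      fix b assume "b \<in> J"
      then obtain m g where b: "b = m + g * (f - c \<mu>)" "m \<in> M" "g \<in> R"
        unfolding J_def by blast
      {
        fix a assume "a \<in> J"
        then obtain n h where a: "a = n + h * (f - c \<mu>)" "n \<in> M" "h \<in> R"
          unfolding J_def by blast
        have "a + b = (n + m) + (h + g) * (f - c \<mu>)"
          by (simp add: a b algebra_simps)
        with a b show "a + b \<in> J"
          unfolding J_def using M_add add_in by blast
      }
      fix a assume a: "a \<in> R"
      have "a * b = a * m + (a * g) * (f - c \<mu>)"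
        by (simp add: b algebra_simps)
      with a b show "a * b \<in> J"
        unfolding J_def using M_mult mult_in by blast
    qed
    moreover have "1 \<notin> J"
    proof
      assume "1 \<in> J"
      then obtain m g where mg: "1 = m + g * (f - c \<mu>)" "m \<in> M" "g \<in> R"
        unfolding J_def by blast
      have "g * (f - c \<mu>) - 1 = 0 - m"
        using mg(1) by (simp add: algebra_simps)
      then have "g * (f - c \<mu>) - 1 \<in> M"
        using ideal_diff[OF M M0 mg(2)] by simp
      with \<mu>[OF mg(3)] show False by simp
    qed
    ultimately have "J = M" using M_max MJ by blast
    moreover have "0 + 1 * (f - c \<mu>) \<in> J"
      unfolding J_def using M0 one_in by blast
    ultimately show ?thesis by auto
  qed
  have unique: "\<mu> = \<nu>" if "f - c \<mu> \<in> M" "f - c \<nu> \<in> M" for f \<mu> \<nu>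
  proof (rule ccontr)
    assume "\<mu> \<noteq> \<nu>"
    have "(f - c \<nu>) - (f - c \<mu>) \<in> M"
      by (rule ideal_diff[OF M that(2,1)])
    then have "c (\<mu> - \<nu>) \<in> M" by (simp add: c_diff)
    then have "c (1 / (\<mu> - \<nu>)) * c (\<mu> - \<nu>) \<in> M"
      by (intro M_mult c_in)
    with \<open>\<mu> \<noteq> \<nu>\<close> M1 show False
      by (simp add: c_one flip: c_mult)
  qed
  define \<psi> where "\<psi> f = (SOME \<mu>. f - c \<mu> \<in> M)" for f
  have \<psi>: "f - c (\<psi> f) \<in> M" if "f \<in> R" for f
    unfolding \<psi>_def using spec[OF that] by (rule someI_ex)
  have \<psi>_eq: "\<psi> f = \<mu>" if "f \<in> R" "f - c \<mu> \<in> M" for f \<mu>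
    using unique \<psi> that by blast
  show ?thesis
  proof (rule that[of \<psi>])
    fix a b assume ab: "a \<in> R" "b \<in> R"
    have "(a - c (\<psi> a)) + (b - c (\<psi> b)) \<in> M"
      using ab by (intro M_add \<psi>)
    then show "\<psi> (a + b) = \<psi> a + \<psi> b"
      using ab by (intro \<psi>_eq) (simp_all add: closed_under c_add algebra_simps)
    \<comment> \<open>This element equals ab - \<psi>(a)\<psi>(b).\<close>
    have "b * (a - c (\<psi> a)) + c (\<psi> a) * (b - c (\<psi> b)) \<in> M"
      using ab by (intro M_add M_mult \<psi> c_in)
    then show "\<psi> (a * b) = \<psi> a * \<psi> b"
      using ab by (intro \<psi>_eq) (simp_all add: closed_under c_mult algebra_simps)
  next
    show "\<psi> (c z) = z" for z
      using M0 c_in by (intro \<psi>_eq) simp_all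
    show "\<psi> a = 0" if "a \<in> I" for a
      using that IM M_sub by (intro \<psi>_eq) (auto simp: c_zero)
  qed
qed

end

section \<open>Regular function algebras\<close>

lemma continuous_on_eval: "continuous_on S (\<lambda>f. apply_bcontfun f x)"
  unfolding continuous_on_iff by (meson dist_fun_lt_imp_dist_val_lt)

lemma banach_function_algebraD:
  assumes "banach_function_algebra A"
  shows "const_bcontfun z \<in> A" "f \<in> A \<Longrightarrow> g \<in> A \<Longrightarrow> f + g \<in> A" "f \<in> A \<Longrightarrow> g \<in> A \<Longrightarrow> f * g \<in> A"
    "f \<in> A \<Longrightarrow> z *\<^sub>C f \<in> A" "0 \<in> A" "1 \<in> A"
proof -
  show const: "const_bcontfun z \<in> A" for z
    using assms unfolding banach_function_algebra_def by blast
  have "const_bcontfun 1 = (1 :: 'a \<Rightarrow>\<^sub>C complex)"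
    by (rule bcontfun_eqI) (simp add: const_bcontfun.rep_eq)
  with const[of 1] show "1 \<in> A" by simp
qed (use assms in \<open>auto simp: banach_function_algebra_def complex_subalgebra_def bcontfun_mult_eq_times\<close>)

text \<open>The Neumann series requires completeness in the supremum norm, which the uniform closure
  of \<open>A\<close> has as a closed subset of a Banach space.\<close>

lemma closed_subalgebra_closure:
  fixes A :: "('x::topological_space \<Rightarrow>\<^sub>C complex) set"
  assumes A: "banach_function_algebra A"
  shows "closed_subalgebra (closure A) const_bcontfun"
proof
  note A_rules = banach_function_algebraD[OF A]
  show "const_bcontfun z \<in> closure A" for z
    using A_rules(1) closure_subset by blast
  show "a + b \<in> closure A" if "a \<in> closure A" "b \<in> closure A" for a b
    by (rule closure_binop[OF A_rules(2) that tendsto_add])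
  show "a * b \<in> closure A" if "a \<in> closure A" "b \<in> closure A" for a b
    by (rule closure_binop[OF A_rules(3) that tendsto_mult])
  show "norm (const_bcontfun z :: 'x \<Rightarrow>\<^sub>C complex) \<le> cmod z" for z
    by (rule norm_bound) (simp add: const_bcontfun.rep_eq)
qed (auto intro!: bcontfun_eqI simp: const_bcontfun.rep_eq)

section \<open>Point evaluations and the maximal ideal space\<close>

definition point_evaluation ::
  "('x::topological_space \<Rightarrow>\<^sub>C complex) set \<Rightarrow> 'x \<Rightarrow> ('x \<Rightarrow>\<^sub>C complex) \<Rightarrow> complex" where
  "point_evaluation A x = restrict (\<lambda>f. apply_bcontfun f x) A"

lemma point_evaluation_character:
  assumes A: "banach_function_algebra A"
  shows "point_evaluation A x \<in> characters A"
  using banach_function_algebraD[OF A]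
  by (auto simp: characters_def point_evaluation_def bcontfun_mult_eq_times scaleC_complex_def
      intro!: bexI[of _ 1])

text \<open>\<open>C\<close> is compact and is mapped continuously into a Hausdorff space, so its
  image is compact and hence closed.\<close>

lemma closedin_point_evaluations:
  fixes A :: "('x::topological_space \<Rightarrow>\<^sub>C complex) set"
  assumes A: "banach_function_algebra A" and C: "compact (UNIV :: 'x set)" "closed C"
  shows "closedin (maximal_ideal_space A) (point_evaluation A ` C)"
proof (rule compactin_imp_closedin)
  show "Hausdorff_space (maximal_ideal_space A)"
    unfolding maximal_ideal_space_def
    by (intro Hausdorff_space_subtopology) (simp add: Hausdorff_space_product_topology)
  have "compactin euclidean C"
    using compact_Int_closed[OF C] by simp
  moreover have "continuous_map euclidean (maximal_ideal_space A) (point_evaluation A)"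
    unfolding maximal_ideal_space_def continuous_map_in_subtopology continuous_map_componentwise
    using point_evaluation_character[OF A]
    by (auto simp: point_evaluation_def)
  ultimately show "compactin (maximal_ideal_space A) (point_evaluation A ` C)"
    by (rule image_compactin)
qed

lemma topspace_maximal_ideal_space: "topspace (maximal_ideal_space A) = characters A"
  by (auto simp: maximal_ideal_space_def characters_def extensional_def PiE_def)

lemma regular_algebraE:
  assumes "regular_algebra A" "closedin (maximal_ideal_space A) K" "\<psi> \<in> characters A" "\<psi> \<notin> K"
  obtains f where "f \<in> A" "\<psi> f = 1" "\<And>\<eta>. \<eta> \<in> K \<Longrightarrow> \<eta> f = 0"
proof -
  have "\<psi> \<in> topspace (maximal_ideal_space A) - K"
    using assms by (simp add: topspace_maximal_ideal_space)
  then have "\<exists>f\<in>A. \<psi> f = 1 \<and> (\<forall>\<eta>\<in>K. \<eta> f = 0)"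
    using assms(1)[unfolded regular_algebra_def gelfand_transform_def] assms(2) by simp
  then show ?thesis using that by (elim bexE conjE) simp
qed

text \<open>Regularity separates the evaluation at \<open>x\<close> from the closed set of
  evaluations on the complement of \<open>U\<close>; the evaluation at \<open>x\<close> is not among
  these because \<open>A\<close> separates points.\<close>

lemma exists_bump:
  fixes A :: "('x::topological_space \<Rightarrow>\<^sub>C complex) set"
  assumes A: "banach_function_algebra A" "regular_algebra A" and X: "compact (UNIV :: 'x set)"
    and x: "open U" "x \<in> U"
  obtains e where "e \<in> A" "apply_bcontfun e x = 1" "\<And>z. z \<notin> U \<Longrightarrow> apply_bcontfun e z = 0"
proof -
  let ?K = "point_evaluation A ` (- U)"
  have "point_evaluation A x \<notin> ?K"
  proof
    assume "point_evaluation A x \<in> ?K"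
    then obtain z where z: "z \<notin> U" "point_evaluation A x = point_evaluation A z"
      by auto
    then obtain f where "f \<in> A" "apply_bcontfun f x \<noteq> apply_bcontfun f z"
      using A(1) x unfolding banach_function_algebra_def by metis
    with fun_cong[OF z(2), of f] show False
      by (simp add: point_evaluation_def)
  qed
  have "closedin (maximal_ideal_space A) ?K"
    using x by (intro closedin_point_evaluations A X closed_Compl)
  then obtain f where f: "f \<in> A" "point_evaluation A x f = 1" "\<And>\<eta>. \<eta> \<in> ?K \<Longrightarrow> \<eta> f = 0"
    using regular_algebraE[OF A(2) _ point_evaluation_character[OF A(1)] \<open>_ \<notin> ?K\<close>] by metis
  show ?thesis
  proof (rule that)
    show "apply_bcontfun f z = 0" if "z \<notin> U" for z
      using f(1) f(3)[of "point_evaluation A z"] that by (simp add: point_evaluation_def)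
  qed (use f in \<open>simp_all add: point_evaluation_def\<close>)
qed

text \<open>Otherwise regularity separates \<psi> from the closed set of all evaluations by some f
  with \<psi>(f) = 1. Such an f vanishes on the whole of X, so f = 0 and \<psi>(f) = 0.\<close>

lemma character_is_point_evaluation:
  fixes A :: "('x::topological_space \<Rightarrow>\<^sub>C complex) set"
  assumes A: "banach_function_algebra A" "regular_algebra A" and X: "compact (UNIV :: 'x set)"
    and \<psi>: "\<psi> \<in> characters A"
  shows "\<exists>x. \<psi> = point_evaluation A x"
proof (rule ccontr)
  assume "\<not> ?thesis"
  then have notin: "\<psi> \<notin> range (point_evaluation A)"
    by blast
  have "closedin (maximal_ideal_space A) (range (point_evaluation A))"
    by (intro closedin_point_evaluations A X) simp
  then obtain f where f: "f \<in> A" "\<psi> f = 1" "\<And>\<eta>. \<eta> \<in> range (point_evaluation A) \<Longrightarrow> \<eta> f = 0"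
    using regular_algebraE[OF A(2) _ \<psi> notin] by metis
  have "apply_bcontfun f x = 0" for x
    using f(3)[of "point_evaluation A x"] f(1) by (simp add: point_evaluation_def)
  then have "f = 0"
    by (intro bcontfun_eqI) simp
  moreover have "\<psi> (0 *\<^sub>C f) = 0 * \<psi> f"
    using \<psi> f(1) unfolding characters_def by blast
  ultimately show False
    using f(2) by (simp add: scaleC_bcontfun_eq_times)
qed

text \<open>The closure of \<open>I\<close> is a proper ideal of the closure of \<open>A\<close>, so
  a character of the latter annihilates it. Restricted to \<open>A\<close> this character is the
  evaluation at the point sought.\<close>

lemma exists_common_zero:
  fixes A :: "('x::topological_space \<Rightarrow>\<^sub>C complex) set"
  assumes A: "banach_function_algebra A" "regular_algebra A" and X: "compact (UNIV :: 'x set)"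
    and I: "ideal_of A I" "1 \<notin> closure I"
  shows "\<exists>x. \<forall>f\<in>I. apply_bcontfun f x = 0"
proof -
  interpret closed_subalgebra "closure A" const_bcontfun
    by (rule closed_subalgebra_closure[OF A(1)])
  have I_rules: "I \<subseteq> A" "0 \<in> I" "\<And>a b. a \<in> I \<Longrightarrow> b \<in> I \<Longrightarrow> a + b \<in> I"
      "\<And>a b. a \<in> A \<Longrightarrow> b \<in> I \<Longrightarrow> a * b \<in> I"
    using I(1) unfolding ideal_of_def by blast+
  have "ideal_of (closure A) (closure I)"
    unfolding ideal_of_def
  proof (intro conjI ballI)
    show "closure I \<subseteq> closure A"
      by (rule closure_mono[OF I_rules(1)])
    show "0 \<in> closure I"
      using I_rules(2) closure_subset by blast
    show "a + b \<in> closure I" if "a \<in> closure I" "b \<in> closure I" for a b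
      by (rule closure_binop[OF I_rules(3) that tendsto_add])
    show "a * b \<in> closure I" if "a \<in> closure A" "b \<in> closure I" for a b
      by (rule closure_binop[OF I_rules(4) that tendsto_mult])
  qed
  then obtain \<psi> where \<psi>: "\<And>a b. a \<in> closure A \<Longrightarrow> b \<in> closure A \<Longrightarrow> \<psi> (a + b) = \<psi> a + \<psi> b"
      "\<And>a b. a \<in> closure A \<Longrightarrow> b \<in> closure A \<Longrightarrow> \<psi> (a * b) = \<psi> a * \<psi> b"
      "\<And>z. \<psi> (const_bcontfun z) = z" "\<And>a. a \<in> closure I \<Longrightarrow> \<psi> a = (0 :: complex)"
    using exists_character[OF _ I(2)] by metis
  have A_sub: "a \<in> closure A" if "a \<in> A" for a
    using that closure_subset by blast
  note A_rules = banach_function_algebraD[OF A(1)]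
  have "restrict \<psi> A \<in> characters A"
    unfolding characters_def
  proof (intro CollectI conjI ballI allI)
    show "restrict \<psi> A (f + g) = restrict \<psi> A f + restrict \<psi> A g"
      "restrict \<psi> A (f \<odot> g) = restrict \<psi> A f * restrict \<psi> A g" if "f \<in> A" "g \<in> A" for f g
      using that A_rules A_sub \<psi> by (simp_all add: bcontfun_mult_eq_times)
    show "restrict \<psi> A (z *\<^sub>C f) = z * restrict \<psi> A f" if "f \<in> A" for z f
      using that A_rules A_sub \<psi> by (simp add: scaleC_bcontfun_eq_times)
    show "\<exists>f\<in>A. restrict \<psi> A f \<noteq> 0"
      using A_rules(1)[of 1] \<psi>(3)[of 1] by (intro bexI[of _ "const_bcontfun 1"]) simp_all
  qed simp
  then obtain x where x: "restrict \<psi> A = point_evaluation A x"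
    using character_is_point_evaluation[OF A X] by blast
  have "apply_bcontfun f x = 0" if "f \<in> I" for f
  proof -
    have "f \<in> A" "f \<in> closure I"
      using that I_rules(1) closure_subset by blast+
    with \<psi>(4) fun_cong[OF x, of f] show ?thesis
      by (simp add: point_evaluation_def)
  qed
  then show ?thesis by blast
qed

section \<open>Jointly separating pairs of functionals\<close>

lemma tendsto_bcontfun_mult_left:
  fixes h :: "'x::topological_space \<Rightarrow>\<^sub>C 'e::complex_normed_vector"
  assumes "f \<longlonglongrightarrow> l"
  shows "(\<lambda>n. f n \<odot> h) \<longlonglongrightarrow> l \<odot> h"
proof -
  have le: "dist (f n \<odot> h) (l \<odot> h) \<le> norm (f n - l) * norm h" for n
  proof (rule dist_bound)
    fix x
    have "dist (apply_bcontfun (f n \<odot> h) x) (apply_bcontfun (l \<odot> h) x)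
        = cmod (apply_bcontfun (f n - l) x) * norm (apply_bcontfun h x)"
      by (simp add: dist_norm flip: norm_scaleC bounded_bilinear.diff_left[OF bounded_bilinear_scaleC])
    also have "\<dots> \<le> norm (f n - l) * norm h"
      by (intro mult_mono norm_bounded) auto
    finally show "dist (apply_bcontfun (f n \<odot> h) x) (apply_bcontfun (l \<odot> h) x) \<le> norm (f n - l) * norm h" .
  qed
  have lim: "(\<lambda>n. norm (f n - l) * norm h) \<longlonglongrightarrow> 0"
    using assms by (intro tendsto_mult_left_zero tendsto_norm_zero) (simp add: LIM_zero_iff)
  have "(\<lambda>n. dist (f n \<odot> h) (l \<odot> h)) \<longlonglongrightarrow> 0"
  proof (rule tendsto_sandwich[OF _ _ tendsto_const lim])
    show "\<forall>\<^sub>F n in sequentially. dist (f n \<odot> h) (l \<odot> h) \<le> norm (f n - l) * norm h"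
      by (intro always_eventually allI le)
  qed simp
  then show ?thesis
    by (rule iffD2[OF tendsto_dist_iff])
qed


text \<open>\<open>x\<close> is a common zero of the ideal \<open>I\<close> of all f that
  \<open>u\<close> annihilates together with their multiples; the conclusion is the contrapositive
  form. With \<open>A\<close> itself in the place of \<open>B\<close> the lemma also serves the
  functional coming from \<open>T\<close>.\<close>

lemma annihilator_common_zero:
  fixes A :: "('x::topological_space \<Rightarrow>\<^sub>C complex) set"
    and B :: "('x \<Rightarrow>\<^sub>C 'e::complex_normed_vector) set"
    and u :: "('x \<Rightarrow>\<^sub>C 'e) \<Rightarrow> 'v::real_normed_vector"
  assumes A: "banach_function_algebra A" "regular_algebra A" and X: "compact (UNIV :: 'x set)"
    and AB: "\<And>f g. f \<in> A \<Longrightarrow> g \<in> B \<Longrightarrow> f \<odot> g \<in> B"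
    and u: "continuous_on B u" "\<And>g h. g \<in> B \<Longrightarrow> h \<in> B \<Longrightarrow> u (g + h) = u g + u h"
    and nonzero: "g0 \<in> B" "u g0 \<noteq> 0"
  obtains x where "\<And>f. f \<in> A \<Longrightarrow> apply_bcontfun f x \<noteq> 0 \<Longrightarrow> \<exists>g\<in>B. u (f \<odot> g) \<noteq> 0"
proof -
  note A_rules = banach_function_algebraD[OF A(1)]
  define I where "I = {f \<in> A. \<forall>g\<in>B. u (f \<odot> g) = 0}"
  have "ideal_of A I"
    unfolding ideal_of_def
  proof (intro conjI ballI)
    have "u (0 \<odot> g) = 0" if "g \<in> B" for g
    proof -
      have "0 \<odot> g \<in> B" using AB A_rules that by blast
      moreover have "0 \<odot> g + 0 \<odot> g = 0 \<odot> g"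
        by (rule bcontfun_eqI) (simp flip: scaleC_add_left)
      ultimately show ?thesis
        using u(2)[of "0 \<odot> g" "0 \<odot> g"] by simp
    qed
    then show "0 \<in> I" unfolding I_def using A_rules by simp
    show "a + b \<in> I" if ab: "a \<in> I" "b \<in> I" for a b
    proof -
      have "(a + b) \<odot> g = a \<odot> g + b \<odot> g" for g :: "'x \<Rightarrow>\<^sub>C 'e"
        by (rule bcontfun_eqI) (simp add: scaleC_add_left)
      with ab show ?thesis
        using A_rules AB u(2) by (simp add: I_def)
    qed
    show "a * b \<in> I" if ab: "a \<in> A" "b \<in> I" for a b
    proof -
      have "(a * b) \<odot> g = b \<odot> (a \<odot> g)" for g :: "'x \<Rightarrow>\<^sub>C 'e"
        by (rule bcontfun_eqI) (simp add: scaleC_scaleC mult.commute)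
      with ab show ?thesis
        using A_rules AB by (simp add: I_def)
    qed
  qed (simp add: I_def)
  \<comment> \<open>If f_n \<rightarrow> 1 with f_n in \<open>I\<close>, then continuity gives u(g0)
    = lim u(f_n g0) = 0.\<close>
  moreover have "1 \<notin> closure I"
  proof
    assume "1 \<in> closure I"
    then obtain f where f: "\<And>n. f n \<in> I" "f \<longlonglongrightarrow> 1"
      unfolding closure_sequential by blast
    have "1 \<odot> g0 = g0"
      using scaleC_of_real[of 1] by (intro bcontfun_eqI) simp
    then have "(\<lambda>n. f n \<odot> g0) \<longlonglongrightarrow> g0"
      using tendsto_bcontfun_mult_left[OF f(2), of g0] by simp
    then have "(\<lambda>n. u (f n \<odot> g0)) \<longlonglongrightarrow> u g0"
      by (rule continuous_on_tendsto_compose[OF u(1) _ nonzero(1)])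
        (use nonzero(1) f(1) AB in \<open>simp add: I_def\<close>)
    moreover have "u (f n \<odot> g0) = 0" for n
      using f(1)[of n] nonzero(1) by (simp add: I_def)
    ultimately show False
      using nonzero(2) by (simp add: LIMSEQ_const_iff)
  qed
  ultimately obtain x where "\<forall>f\<in>I. apply_bcontfun f x = 0"
    using exists_common_zero[OF A X] by blast
  then show ?thesis
    by (intro that[of x]) (auto simp: I_def)
qed

text \<open>Property (P) approximates \<open>g\<close> by functions vanishing near \<open>x\<close>;
  \<open>u\<close> sends these to 0 and is continuous on \<open>B\<close>.\<close>

lemma property_P_vanish:
  assumes "property_P B" "continuous_on B u"
    and vanish: "\<And>U g. open U \<Longrightarrow> x \<in> U \<Longrightarrow> g \<in> B \<Longrightarrow> (\<And>z. z \<in> U \<Longrightarrow> apply_bcontfun g z = 0) \<Longrightarrow> u g = 0"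
    and g: "g \<in> B" "apply_bcontfun g x = 0"
  shows "u g = (0 :: 'v::real_normed_vector)"
proof -
  obtain s where s: "\<forall>n. s n \<in> B \<and> (\<exists>U. open U \<and> x \<in> U \<and> (\<forall>z\<in>U. apply_bcontfun (s n) z = 0))"
      and lim: "s \<longlonglongrightarrow> g"
    using assms(1)[unfolded property_P_def, rule_format, OF g] by (elim exE conjE)
  have "(\<lambda>n. u (s n)) \<longlonglongrightarrow> u g"
    by (rule continuous_on_tendsto_compose[OF assms(2) lim g(1)]) (simp add: s)
  moreover have "u (s n) = 0" for n
  proof -
    from s have "s n \<in> B" "\<exists>U. open U \<and> x \<in> U \<and> (\<forall>z\<in>U. apply_bcontfun (s n) z = 0)"
      by simp_all
    then show ?thesis
      by (elim exE conjE) (simp add: vanish)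
  qed
  ultimately show ?thesis
    by (simp add: LIMSEQ_const_iff)
qed

text \<open>This is applied to \<open>T\<close> and \<open>S\<close> followed by evaluation at one
  point of Y. Values in arbitrary normed spaces allow for F, and \<open>sep\<close> expresses
  separation without a product of the two values.\<close>

lemma joint_support_point:
  fixes A :: "('x::t2_space \<Rightarrow>\<^sub>C complex) set"
    and B :: "('x \<Rightarrow>\<^sub>C 'e::complex_normed_vector) set"
    and t :: "('x \<Rightarrow>\<^sub>C complex) \<Rightarrow> 'u::real_normed_vector"
    and s :: "('x \<Rightarrow>\<^sub>C 'e) \<Rightarrow> 'v::real_normed_vector"
  assumes A: "banach_function_algebra A" "regular_algebra A" and X: "compact (UNIV :: 'x set)"
    and AB: "\<And>f g. f \<in> A \<Longrightarrow> g \<in> B \<Longrightarrow> f \<odot> g \<in> B"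
    and P: "property_P A" "property_P B"
    and t: "continuous_on A t" "\<And>f h. f \<in> A \<Longrightarrow> h \<in> A \<Longrightarrow> t (f + h) = t f + t h"
      "f0 \<in> A" "t f0 \<noteq> 0"
    and s: "continuous_on B s" "\<And>g h. g \<in> B \<Longrightarrow> h \<in> B \<Longrightarrow> s (g + h) = s g + s h"
      "g0 \<in> B" "s g0 \<noteq> 0"
    and sep: "\<And>f g. f \<in> A \<Longrightarrow> g \<in> B \<Longrightarrow>
      coz (apply_bcontfun f) \<inter> coz (apply_bcontfun g) = {} \<Longrightarrow> t f = 0 \<or> s g = 0"
  shows "\<exists>x. (\<forall>f\<in>A. apply_bcontfun f x = 0 \<longrightarrow> t f = 0) \<and>
    (\<forall>g\<in>B. apply_bcontfun g x = 0 \<longrightarrow> s g = 0)"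
proof -
  have AA: "f \<odot> h \<in> A" if "f \<in> A" "h \<in> A" for f h
    using that banach_function_algebraD(3)[OF A(1)] by (simp add: bcontfun_mult_eq_times)
  obtain a where a: "\<And>f. f \<in> A \<Longrightarrow> apply_bcontfun f a \<noteq> 0 \<Longrightarrow> \<exists>h\<in>A. t (f \<odot> h) \<noteq> 0"
    using annihilator_common_zero[OF A X AA t] by metis
  obtain b where b: "\<And>f. f \<in> A \<Longrightarrow> apply_bcontfun f b \<noteq> 0 \<Longrightarrow> \<exists>g\<in>B. s (f \<odot> g) \<noteq> 0"
    using annihilator_common_zero[OF A X AB s] by metis
  have t_local: "t f = 0"
    if U: "open U" "b \<in> U" and f: "f \<in> A" "\<And>z. z \<in> U \<Longrightarrow> apply_bcontfun f z = 0" for U f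
  proof -
    obtain e where e: "e \<in> A" "apply_bcontfun e b = 1" "\<And>z. z \<notin> U \<Longrightarrow> apply_bcontfun e z = 0"
      using exists_bump[OF A X U] by metis
    then obtain g where g: "g \<in> B" "s (e \<odot> g) \<noteq> 0"
      using b[of e] by auto
    have "0 *\<^sub>C v = 0" for v :: 'e
      using norm_scaleC[of 0 v] by simp
    then have "coz (apply_bcontfun f) \<inter> coz (apply_bcontfun (e \<odot> g)) = {}"
      using e(3) f(2) by (auto simp: coz_def) metis
    then show ?thesis
      using sep[OF f(1) AB[OF e(1) g(1)]] g(2) by blast
  qed
  have s_local: "s g = 0"
    if U: "open U" "a \<in> U" and g: "g \<in> B" "\<And>z. z \<in> U \<Longrightarrow> apply_bcontfun g z = 0" for U g
  proof -
    obtain e where e: "e \<in> A" "apply_bcontfun e a = 1" "\<And>z. z \<notin> U \<Longrightarrow> apply_bcontfun e z = 0"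
      using exists_bump[OF A X U] by metis
    then obtain h where h: "h \<in> A" "t (e \<odot> h) \<noteq> 0"
      using a[of e] by auto
    have "coz (apply_bcontfun (e \<odot> h)) \<inter> coz (apply_bcontfun g) = {}"
      using e(3) g(2) by (auto simp: coz_def scaleC_complex_def)
    then show ?thesis
      using sep[OF AA[OF e(1) h(1)] g(1)] h(2) by blast
  qed
  \<comment> \<open>A bump around \<open>a\<close> supported away from a neighbourhood of
    \<open>b\<close> has all its multiples annihilated by \<open>t_local\<close>, although
    \<open>h\<close> was chosen with \<open>t (e \<odot> h) \<noteq> 0\<close>.\<close>
  have "a = b"
  proof (rule ccontr)
    assume "a \<noteq> b"
    then obtain U V where UV: "open U" "open V" "a \<in> U" "b \<in> V" "U \<inter> V = {}"
      by (meson hausdorff)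
    obtain e where e: "e \<in> A" "apply_bcontfun e a = 1" "\<And>z. z \<notin> U \<Longrightarrow> apply_bcontfun e z = 0"
      using exists_bump[OF A X UV(1,3)] by metis
    then obtain h where h: "h \<in> A" "t (e \<odot> h) \<noteq> 0"
      using a[of e] by auto
    have "t (e \<odot> h) = 0"
      using e(3) UV(5) by (intro t_local[OF UV(2,4) AA] e h) (auto simp: scaleC_complex_def)
    with h(2) show False by simp
  qed
  then show ?thesis
    using property_P_vanish[OF P(1) t(1), of b] property_P_vanish[OF P(2) s(1), of b]
      t_local s_local by blast
qed

section \<open>The map \<phi> and the representation of \<open>T\<close> and
  \<open>S\<close>\<close>

theorem corollary5p2:
  fixes A :: "('x::t2_space \<Rightarrow>\<^sub>C complex) set"
    and B :: "('x \<Rightarrow>\<^sub>C 'e::complex_banach) set"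
    and T :: "('x \<Rightarrow>\<^sub>C complex) \<Rightarrow> ('y::t2_space \<Rightarrow>\<^sub>C complex)"
    and S :: "('x \<Rightarrow>\<^sub>C 'e) \<Rightarrow> ('y \<Rightarrow>\<^sub>C 'f::banach)"
  assumes compact_X: "compact (UNIV :: 'x set)"
    and compact_Y: "compact (UNIV :: 'y set)"
    and F_nontrivial: "(UNIV :: 'f set) \<noteq> {0}"
    and B_subspace: "subspace B"
    and B_constants: "range const_bcontfun \<subseteq> B"
    and A_algebra: "banach_function_algebra A"
    and A_regular: "regular_algebra A"
    and AB_subset: "{f \<odot> h | f h. f \<in> A \<and> h \<in> B} \<subseteq> B"
    and P_B: "property_P B"
    and P_A: "property_P A"
    and T_cont: "continuous_on A T"
    and S_cont: "continuous_on B S"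
    and T_lin: "real_linear_on A T"
    and S_lin: "real_linear_on B S"
    and joint: "jointly_separating A B T S"
    and T_range: "range const_bcontfun \<subseteq> T ` A"
    and S_range: "range const_bcontfun \<subseteq> S ` B"
  shows "\<exists>(\<phi> :: 'y \<Rightarrow> 'x) (\<Lambda> :: 'y \<Rightarrow> ('e \<Rightarrow>\<^sub>L 'f)).
    continuous_on UNIV \<phi> \<and>
    continuous_map euclidean strong_operator_topology \<Lambda> \<and>
    (\<forall>f\<in>A. \<forall>y. T f y =
        complex_of_real (Re (apply_bcontfun f (\<phi> y))) * T (const_bcontfun 1) y +
        complex_of_real (Im (apply_bcontfun f (\<phi> y))) * T (const_bcontfun \<i>) y) \<and>
    (\<forall>g\<in>B. \<forall>y. S g y = \<Lambda> y (apply_bcontfun g (\<phi> y)))"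
proof -
  note A_rules = banach_function_algebraD[OF A_algebra]
  have const_A: "const_bcontfun z \<in> A" and const_B: "const_bcontfun v \<in> B" for z v
    using A_rules(1) B_constants by auto
  have AB: "f \<odot> g \<in> B" if "f \<in> A" "g \<in> B" for f g
    using AB_subset that by blast
  have T_add: "T (f + g) = T f + T g" and T_scale: "T (r *\<^sub>R f) = r *\<^sub>R T f" if "f \<in> A" "g \<in> A" for f g r
    using T_lin that unfolding real_linear_on_def by blast+
  have S_add: "S (f + g) = S f + S g" and S_scale: "S (r *\<^sub>R f) = r *\<^sub>R S f" if "f \<in> B" "g \<in> B" for f g r
    using S_lin that unfolding real_linear_on_def by blast+
  have T_cont_at: "continuous_on A (\<lambda>f. apply_bcontfun (T f) y)" for y
    by (rule continuous_on_compose2[OF continuous_on_eval[of UNIV] T_cont]) simp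
  have S_cont_at: "continuous_on B (\<lambda>g. apply_bcontfun (S g) y)" for y
    by (rule continuous_on_compose2[OF continuous_on_eval[of UNIV] S_cont]) simp
  \<comment> \<open>Preimages of nonzero constants make both functionals nonzero at every y at
    once.\<close>
  have "const_bcontfun 1 \<in> T ` A"
    using T_range by blast
  then obtain f0 where f0: "f0 \<in> A" "T f0 = const_bcontfun 1"
    by (elim imageE) simp
  obtain v :: 'f where v: "v \<noteq> 0"
    using F_nontrivial by auto
  have "const_bcontfun v \<in> S ` B"
    using S_range by blast
  then obtain g0 where g0: "g0 \<in> B" "S g0 = const_bcontfun v"
    by (elim imageE) simp
  have "\<exists>x. (\<forall>f\<in>A. apply_bcontfun f x = 0 \<longrightarrow> apply_bcontfun (T f) y = 0) \<and>
      (\<forall>g\<in>B. apply_bcontfun g x = 0 \<longrightarrow> apply_bcontfun (S g) y = 0)" for y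
  proof (rule joint_support_point[OF A_algebra A_regular compact_X AB P_A P_B T_cont_at _ f0(1) _ S_cont_at _ g0(1)])
    fix f g
    assume "f \<in> A" "g \<in> B" "coz (apply_bcontfun f) \<inter> coz (apply_bcontfun g) = {}"
    then have "coz (apply_bcontfun (T f)) \<inter> coz (apply_bcontfun (S g)) = {}"
      using joint unfolding jointly_separating_def by blast
    then show "apply_bcontfun (T f) y = 0 \<or> apply_bcontfun (S g) y = 0"
      unfolding coz_def by blast
  qed (simp_all add: T_add S_add f0(2) g0(2) v const_bcontfun.rep_eq)
  then obtain \<phi>
    where \<phi>_T: "\<And>f y. f \<in> A \<Longrightarrow> apply_bcontfun f (\<phi> y) = 0 \<Longrightarrow> apply_bcontfun (T f) y = 0"
      and \<phi>_S: "\<And>g y. g \<in> B \<Longrightarrow> apply_bcontfun g (\<phi> y) = 0 \<Longrightarrow> apply_bcontfun (S g) y = 0"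
    by metis
  \<comment> \<open>The difference of \<open>f\<close> and \<open>h\<close> vanishes at
    \<open>\<phi> y\<close>, so additivity applies.\<close>
  have T_eq: "apply_bcontfun (T f) y = apply_bcontfun (T h) y"
    if f: "f \<in> A" and h: "h \<in> A" and eq: "apply_bcontfun f (\<phi> y) = apply_bcontfun h (\<phi> y)" for f h y
  proof -
    have neg: "(- 1) *\<^sub>R h \<in> A"
      using A_rules(4)[OF h, of "- 1"] scaleC_of_real[of "- 1" h] by simp
    have "apply_bcontfun (T (f + (- 1) *\<^sub>R h)) y = 0"
      using eq by (intro \<phi>_T A_rules f neg) simp
    then show ?thesis
      using T_add[OF f neg] T_scale[OF h h, of "- 1"] by simp
  qed
  have S_eq: "apply_bcontfun (S g) y = apply_bcontfun (S h) y"
    if g: "g \<in> B" and h: "h \<in> B" and eq: "apply_bcontfun g (\<phi> y) = apply_bcontfun h (\<phi> y)" for g h y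
  proof -
    have neg: "(- 1) *\<^sub>R h \<in> B"
      by (rule subspace_scale[OF B_subspace h])
    have "apply_bcontfun (S (g + (- 1) *\<^sub>R h)) y = 0"
      using eq by (intro \<phi>_S subspace_add[OF B_subspace] g neg) simp
    then show ?thesis
      using S_add[OF g neg] S_scale[OF h h, of "- 1"] by simp
  qed
  have T_form: "apply_bcontfun (T f) y =
      complex_of_real (Re (apply_bcontfun f (\<phi> y))) * apply_bcontfun (T (const_bcontfun 1)) y +
      complex_of_real (Im (apply_bcontfun f (\<phi> y))) * apply_bcontfun (T (const_bcontfun \<i>)) y"
    if f: "f \<in> A" for f y
  proof -
    let ?a = "Re (apply_bcontfun f (\<phi> y))" and ?b = "Im (apply_bcontfun f (\<phi> y))"
    have scaled: "r *\<^sub>R const_bcontfun z \<in> A" for r z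
      using A_rules(4)[OF const_A, of "of_real r" z] by (simp add: scaleC_of_real)
    \<comment> \<open>\<open>f\<close> is replaced by the real combination of the constants 1 and i
      with the same value at \<open>\<phi> y\<close>.\<close>
    have "apply_bcontfun (T f) y
        = apply_bcontfun (T (?a *\<^sub>R const_bcontfun 1 + ?b *\<^sub>R const_bcontfun \<i>)) y"
      by (intro T_eq f A_rules(2) scaled) (simp add: const_bcontfun.rep_eq complex_eq_iff)
    then show ?thesis
      using T_add[OF scaled scaled, of ?a 1 ?b \<i>] T_scale[OF const_A const_A]
      by (simp add: scaleR_conv_of_real[where 'a = complex])
  qed
  have "continuous_on UNIV \<phi>"
    unfolding continuous_on_eq_continuous_within continuous_at_open
  proof (intro ballI allI impI)
    fix y U assume "open U \<and> \<phi> y \<in> U"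
    then obtain e where e: "e \<in> A" "apply_bcontfun e (\<phi> y) = 1" "\<And>z. z \<notin> U \<Longrightarrow> apply_bcontfun e z = 0"
      using exists_bump[OF A_algebra A_regular compact_X] by metis
    \<comment> \<open>\<open>f\<close> agrees with \<open>f0\<close> at \<open>\<phi> y\<close>, so
      \<open>T f\<close> is 1 at y and nonzero nearby. Wherever \<open>T f\<close> is nonzero at y',
      \<open>f\<close> is nonzero at \<open>\<phi> y'\<close>, which puts \<open>\<phi> y'\<close>
      into \<open>U\<close>.\<close>
    define f where "f = f0 * e"
    have f: "f \<in> A" "\<And>z. z \<notin> U \<Longrightarrow> apply_bcontfun f z = 0"
      using f0(1) e A_rules(3) by (simp_all add: f_def)
    have "apply_bcontfun (T f) y = 1"
      using T_eq[of f f0 y] f(1) f0 e(2) by (simp add: f_def const_bcontfun.rep_eq)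
    moreover have "open (- (apply_bcontfun (T f) -` {0}))"
      by (intro open_Compl closed_vimage continuous_on_apply_bcontfun) simp
    moreover have "\<phi> y' \<in> U" if "apply_bcontfun (T f) y' \<noteq> 0" for y'
      using \<phi>_T[of f y'] f that by blast
    ultimately show "\<exists>V. open V \<and> y \<in> V \<and> (\<forall>y'\<in>V. \<phi> y' \<in> U)"
      by (intro exI[of _ "- (apply_bcontfun (T f) -` {0})"]) auto
  qed
  moreover
  \<comment> \<open>By \<open>S_eq\<close> the value of \<open>S g\<close> at y depends only on the
    value of g at \<open>\<phi> y\<close>, so constants determine the operator.\<close>
  define \<Lambda> where "\<Lambda> y = Blinfun (\<lambda>v. apply_bcontfun (S (const_bcontfun v)) y)" for y
  have \<Lambda>: "blinfun_apply (\<Lambda> y) v = apply_bcontfun (S (const_bcontfun v)) y" for y v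
  proof -
    interpret const: bounded_linear "const_bcontfun :: 'e \<Rightarrow> 'x \<Rightarrow>\<^sub>C 'e"
      by (rule bounded_linear_const_bcontfun)
    have "bounded_linear (\<lambda>v. apply_bcontfun (S (const_bcontfun v)) y)"
    proof (rule bounded_linear_if_continuous)
      show "linear (\<lambda>v. apply_bcontfun (S (const_bcontfun v)) y)"
        by (rule linearI) (simp_all add: const.add const.scale S_add[OF const_B const_B] S_scale[OF const_B const_B])
      have "continuous_on UNIV (\<lambda>v. apply_bcontfun (S (const_bcontfun v)) y)"
        using const_B
        by (intro continuous_on_compose2[OF S_cont_at, of _ const_bcontfun] const.continuous_on continuous_on_id) auto
      then show "isCont (\<lambda>v. apply_bcontfun (S (const_bcontfun v)) y) 0"
        by (simp add: continuous_on_eq_continuous_at)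
    qed
    then show ?thesis
      by (simp add: \<Lambda>_def bounded_linear_Blinfun_apply)
  qed
  \<comment> \<open>For fixed v, the map y \<mapsto> \<Lambda>(y)(v) is the continuous function
    \<open>S (const_bcontfun v)\<close>.\<close>
  have "continuous_map euclidean strong_operator_topology \<Lambda>"
    unfolding continuous_on_strong_operator_topo_iff_coordinatewise
    by (simp add: \<Lambda>)
  moreover have "apply_bcontfun (S g) y = blinfun_apply (\<Lambda> y) (apply_bcontfun g (\<phi> y))" if "g \<in> B" for g y
    unfolding \<Lambda> by (intro S_eq that const_B) (simp add: const_bcontfun.rep_eq)
  ultimately show ?thesis
    using T_form by blast
qed

end
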